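(* Let $A$ be a finite abelian group. Suppose its Sylow $2$-subgroup is of type $e$. Then $$\mathrm{Spec}_R(A) = \{d \in \mathbb{N} \mid d \text{ divides } |A| \text{ and } \nu_2(d) \geq b(e) + c(e)\}.$$
   Context: Reidemeister spectrum: for a group $G$ and an endomorphism $\varphi$ of $G$, elements $x,y\in G$ are $\varphi$-conjugate if there is $z \in G$ with $x = z y \varphi(z)^{-1}$. The Reidemeister number $R(\varphi)$ is the number of $\varphi$-conjugacy classes, and $\mathrm{Spec}_R(G) = \{R(\psi) \mid \psi \in \mathrm{Aut}(G)\}$. Types: for an integer $n \geq 1$, $E(n)$ is the set of $e=(e_1,\ldots,e_n)\in\mathbb{Z}^n$ with $1 \leq e_1 \leq e_2 \leq \cdots \leq e_n$. For a prime $p$, a finite abelian $p$-group is of type $e \in E(n)$ if it is isomorphic to $\bigoplus_{i=1}^n \mathbb{Z}/p^{e_i}\mathbb{Z}$. By convention, the trivial group is of the empty type $e=()$, for which $b(e)=c(e)=0$. $abc$-decomposition: given $e \in E(n)$, its entries are decomposed into blocks as follows. Step 1: each maximal constant subsequence (of consecutive entries) of $e_1,\ldots,e_n$ of length at least $2$ forms one block, called an $a$-block. Step 2: among the remaining entries, starting from the left, one looks for successive entries $e_i, e_{i+1}$ (both not yet placed in a block) with $e_{i+1} = e_i + 1$; each such pair forms one block, called a $b$-block (the search is greedy from left to right and each entry belongs to at most one block). Step 3: each remaining entry forms a block by itself, called a $c$-block. The numbers of $a$-, $b$- and $c$-blocks are denoted $a(e)$, $b(e)$, $c(e)$. $\nu_2(d)$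 denotes the $2$-adic valuation of $d$. *)

theory Defs
  imports
    "HOL-Algebra.Bij"
    "HOL-Algebra.Product_Groups"
    "HOL-Computational_Algebra.Primes"
begin

definition twisted_conj :: "('a, 'b) monoid_scheme \<Rightarrow> ('a \<Rightarrow> 'a) \<Rightarrow> ('a \<times> 'a) set" where
  "twisted_conj G \<phi> =
    {(x, y) \<in> carrier G \<times> carrier G.
       \<exists>z\<in>carrier G. x = z \<otimes>\<^bsub>G\<^esub> y \<otimes>\<^bsub>G\<^esub> inv\<^bsub>G\<^esub> (\<phi> z)}"

(* As a natural number, this is the number of classes only when there are finitely many of
   them, as for a finite group: card yields 0 on an infinite set of classes. *)
definition Reidemeister_number :: "('a, 'b) monoid_scheme \<Rightarrow> ('a \<Rightarrow> 'a) \<Rightarrow> nat" where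
  "Reidemeister_number G \<phi> = card (carrier G // twisted_conj G \<phi>)"

definition Reidemeister_spectrum :: "('a, 'b) monoid_scheme \<Rightarrow> nat set" where
  "Reidemeister_spectrum G = {Reidemeister_number G \<psi> | \<psi>. \<psi> \<in> auto G}"

definition sylow_subgroup :: "nat \<Rightarrow> 'a set \<Rightarrow> ('a, 'b) monoid_scheme \<Rightarrow> bool" where
  "sylow_subgroup p P G \<longleftrightarrow> subgroup P G \<and> card P = p ^ multiplicity p (order G)"

(* For n >= 1 this is the set E(n); types 0 contains just the empty type.  List positions are
   counted from 0, so e ! i is the entry with index i + 1 of the sequence. *)
definition types :: "nat \<Rightarrow> nat list set" where
  "types n = {e. length e = n \<and> sorted e \<and> (\<forall>x\<in>set e. 1 \<le> x)}"

definition has_type :: "('a, 'b) monoid_scheme \<Rightarrow> nat \<Rightarrow> nat list \<Rightarrow> bool" where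
  "has_type G p e \<longleftrightarrow>
     e \<in> types (length e) \<and> G \<cong> sum_group {..<length e} (\<lambda>i. integer_mod_group (p ^ (e ! i)))"

(* The blocks of the abc-decomposition are represented as sets of positions. *)

definition a_blocks :: "nat list \<Rightarrow> nat set set" where
  "a_blocks e =
    {{i..<j} | i j. i + 2 \<le> j \<and> j \<le> length e \<and> (\<forall>k\<in>{i..<j}. e ! k = e ! i) \<and>
       (i = 0 \<or> e ! (i - 1) \<noteq> e ! i) \<and> (j = length e \<or> e ! j \<noteq> e ! i)}"

definition b_candidate :: "nat list \<Rightarrow> nat \<Rightarrow> bool" where
  "b_candidate e i \<longleftrightarrow>
     Suc i < length e \<and> i \<notin> \<Union> (a_blocks e) \<and> Suc i \<notin> \<Union> (a_blocks e) \<and> e ! Suc i = e ! i + 1"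

(* Position i is where the search from the left opens a b-block {i, i + 1}; this requires that
   i is not already the second position of the b-block opened at i - 1. *)
fun b_start :: "nat list \<Rightarrow> nat \<Rightarrow> bool" where
  "b_start e 0 \<longleftrightarrow> b_candidate e 0"
| "b_start e (Suc i) \<longleftrightarrow> b_candidate e (Suc i) \<and> \<not> b_start e i"

definition b_blocks :: "nat list \<Rightarrow> nat set set" where
  "b_blocks e = {{i, Suc i} | i. b_start e i}"

definition c_blocks :: "nat list \<Rightarrow> nat set set" where
  "c_blocks e = {{i} | i. i < length e \<and> i \<notin> \<Union> (a_blocks e) \<and> i \<notin> \<Union> (b_blocks e)}"

definition num_b :: "nat list \<Rightarrow> nat" where
  "num_b e = card (b_blocks e)"

definition num_c :: "nat list \<Rightarrow> nat" where
  "num_c e = card (c_blocks e)"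

end

theory Submission
  imports Defs "HOL-Algebra.Sylow" "HOL-Algebra.Multiplicative_Group"
begin

text \<open>
  For an endomorphism \<open>\<phi>\<close> of a finite abelian group \<open>G\<close>, the \<open>\<phi>\<close>-conjugacy classes are the
  cosets of the image of \<open>\<theta>(x) = x \<phi>(x)\<^sup>-\<^sup>1\<close>. Hence \<open>R(\<phi>) = |G| / |\<theta>(G)| = |ker \<theta>|\<close> is the number of
  fixed points of \<open>\<phi>\<close> (\<open>Reidemeister_number_eq_card_fixed_points\<close>), and the spectrum consists of the
  orders of the fixed point groups of automorphisms. It depends only on the isomorphism type, and
  the spectrum of a direct product contains all products of members of the two spectra. Write
  \<open>A = P \<times> K\<close> with \<open>P\<close> the Sylow 2-subgroup and \<open>K\<close> of odd order.

  The odd part gives no obstruction: \<open>K\<close> is a product of cyclic groups of odd prime power order,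
  and on \<open>\<int>/p\<^sup>k\<close> multiplication by \<open>1 + p\<^sup>j\<close> fixes \<open>p\<^sup>j\<close> elements for \<open>1 \<le> j \<le> k\<close>, while doubling
  fixes only 0. So all divisors of \<open>|K|\<close> occur (\<open>divisors_in_spectrum_odd\<close>).

  In \<open>\<int>/2\<^sup>k\<close> every automorphism fixes the element of order 2, so a c-block costs a factor 2. Two or
  three copies of the same cyclic group cost nothing, because \<open>(x, y) \<mapsto> (y, x + y)\<close> and
  \<open>(x, y, z) \<mapsto> (y, z, x + y)\<close> fix only 0; so an a-block is free. On the group
  \<open>\<int>/2\<^sup>k \<oplus> \<int>/2\<^sup>k\<^sup>+\<^sup>1\<close> of a b-block the automorphism \<open>(x, y) \<mapsto> (x + y, 2x + y)\<close> fixes just two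
  elements, so a whole b-block costs only one factor 2. Taking products over the blocks,
  all exponents from \<open>b(e) + c(e)\<close> up to that of \<open>|P|\<close> occur (\<open>realizes_from_type\<close>).

  Conversely, let \<open>T\<close> be the set of the entries of \<open>e\<close> that form a c-block or open a b-block. Each of them
  occurs only once in \<open>e\<close>, and the greedy search ensures that no two of them are consecutive
  integers. Let \<open>f(v)\<close> and \<open>g(v)\<close> be the number of \<open>t \<in> T\<close> with \<open>t < v\<close> and with \<open>t \<le> v\<close>, and let \<open>B\<close> and
  \<open>C\<close> consist of the elements whose i-th coordinates are divisible by \<open>2\<close> to the power \<open>f(e\<^sub>i)\<close> and
  \<open>g(e\<^sub>i)\<close>, respectively. Then \<open>C \<subseteq> B\<close> has index \<open>2\<close> to the power \<open>|T| = b(e) + c(e)\<close>, and every automorphism acts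
  trivially on \<open>B/C\<close>, that is, \<open>\<theta>(B) \<subseteq> C\<close>. Since \<open>|B| \<le> |ker \<theta>| |C|\<close>, there are at least
  \<open>|B : C|\<close> fixed points (\<open>card_fixed_points_two_group_ge\<close>).
\<close>

section \<open>Reidemeister numbers as fixed point counts\<close>

definition fixed_points :: "('a, 'b) monoid_scheme \<Rightarrow> ('a \<Rightarrow> 'a) \<Rightarrow> 'a set" where
  "fixed_points G \<psi> = {x \<in> carrier G. \<psi> x = x}"

lemma subgroup_fixed_points:
  assumes "group G" "\<psi> \<in> hom G G"
  shows "subgroup (fixed_points G \<psi>) G"
proof -
  interpret group_hom G G \<psi> using assms by (simp add: group_hom_def group_hom_axioms_def)
  show ?thesis
    by (rule G.subgroupI) (auto simp: fixed_points_def)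
qed

lemma card_kernel_mult_card_image:
  assumes "group G" "group H" "h \<in> hom G H"
  shows "card (kernel G H h) * card (h ` carrier G) = order G"
proof -
  interpret group_hom G H h using assms by (simp add: group_hom_def group_hom_axioms_def)
  have "G Mod kernel G H h \<cong> H\<lparr>carrier := h ` carrier G\<rparr>"
  proof -
    interpret I: group "H\<lparr>carrier := h ` carrier G\<rparr>"
      by (simp add: subgroup.subgroup_is_group img_is_subgroup)
    interpret h': group_hom G "H\<lparr>carrier := h ` carrier G\<rparr>" h
      by unfold_locales (auto simp: hom_def)
    have "kernel G (H\<lparr>carrier := h ` carrier G\<rparr>) h = kernel G H h"
      by (simp add: kernel_def)
    then show ?thesis using h'.FactGroup_iso by simp
  qed
  from iso_same_card[OF this]
  have "card (rcosets\<^bsub>G\<^esub> (kernel G H h)) = card (h ` carrier G)"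
    by (simp add: FactGroup_def)
  then show ?thesis
    using G.lagrange[OF subgroup_kernel] by (simp add: mult.commute)
qed

text \<open>This is \<open>id - \<psi>\<close> in additive notation.\<close>

definition displacement :: "('a, 'b) monoid_scheme \<Rightarrow> ('a \<Rightarrow> 'a) \<Rightarrow> 'a \<Rightarrow> 'a" where
  "displacement G \<psi> x = x \<otimes>\<^bsub>G\<^esub> inv\<^bsub>G\<^esub> (\<psi> x)"

lemma displacement_hom:
  assumes "comm_group G" "\<psi> \<in> hom G G"
  shows "displacement G \<psi> \<in> hom G G"
proof -
  interpret comm_group G by fact
  interpret group_hom G G \<psi> using assms by (simp add: group_hom_def group_hom_axioms_def)
  show ?thesis
    by (rule homI) (auto simp: displacement_def inv_mult m_ac)
qed

lemma kernel_displacement: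
  assumes "group G" "\<psi> \<in> hom G G"
  shows "kernel G G (displacement G \<psi>) = fixed_points G \<psi>"
proof -
  interpret group_hom G G \<psi> using assms by (simp add: group_hom_def group_hom_axioms_def)
  show ?thesis
    by (force simp: kernel_def fixed_points_def displacement_def G.inv_solve_right')
qed

text \<open>Both the number of classes and the number of fixed points are the index of the image of the
  displacement: the classes are its cosets, and the fixed points form its kernel.\<close>

theorem Reidemeister_number_eq_card_fixed_points:
  assumes "comm_group G" "finite (carrier G)" "\<psi> \<in> hom G G"
  shows "Reidemeister_number G \<psi> = card (fixed_points G \<psi>)"
proof -
  interpret comm_group G by fact
  interpret D: group_hom G G "displacement G \<psi>"
    using displacement_hom assms by (simp add: group_hom_def group_hom_axioms_def)
  interpret P: group_hom G G \<psi>
    using assms by (simp add: group_hom_def group_hom_axioms_def)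
  let ?I = "displacement G \<psi> ` carrier G"
  have I: "subgroup ?I G" by (rule D.img_is_subgroup)
  interpret I: subgroup ?I G by (rule I)
  \<comment> \<open>Solves \<open>x = z y a\<^sup>-\<^sup>1\<close> for \<open>y\<close>.\<close>
  have move: "inv\<^bsub>G\<^esub> z \<otimes>\<^bsub>G\<^esub> a \<otimes>\<^bsub>G\<^esub> (z \<otimes>\<^bsub>G\<^esub> y \<otimes>\<^bsub>G\<^esub> inv\<^bsub>G\<^esub> a) = y"
    if "z \<in> carrier G" "a \<in> carrier G" "y \<in> carrier G" for z a y
  proof -
    have "inv\<^bsub>G\<^esub> z \<otimes>\<^bsub>G\<^esub> a \<otimes>\<^bsub>G\<^esub> (z \<otimes>\<^bsub>G\<^esub> y \<otimes>\<^bsub>G\<^esub> inv\<^bsub>G\<^esub> a)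
      = (inv\<^bsub>G\<^esub> z \<otimes>\<^bsub>G\<^esub> z) \<otimes>\<^bsub>G\<^esub> ((inv\<^bsub>G\<^esub> a \<otimes>\<^bsub>G\<^esub> a) \<otimes>\<^bsub>G\<^esub> y)"
      using that by (simp only: m_ac m_closed inv_closed)
    then show ?thesis using that by simp
  qed
  have cls: "twisted_conj G \<psi> `` {x} = ?I #>\<^bsub>G\<^esub> x" if x: "x \<in> carrier G" for x
  proof (rule subset_antisym; rule subsetI)
    fix y assume "y \<in> twisted_conj G \<psi> `` {x}"
    then obtain z where z: "z \<in> carrier G" "y \<in> carrier G"
      "x = z \<otimes>\<^bsub>G\<^esub> y \<otimes>\<^bsub>G\<^esub> inv\<^bsub>G\<^esub> (\<psi> z)"
      by (auto simp: twisted_conj_def)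
    then have "y = displacement G \<psi> (inv\<^bsub>G\<^esub> z) \<otimes>\<^bsub>G\<^esub> x"
      using move[of z "\<psi> z" y] by (simp add: displacement_def)
    moreover have "displacement G \<psi> (inv\<^bsub>G\<^esub> z) \<otimes>\<^bsub>G\<^esub> x \<in> ?I #>\<^bsub>G\<^esub> x"
      using z(1) x by (intro rcosI imageI I.subset) auto
    ultimately show "y \<in> ?I #>\<^bsub>G\<^esub> x" by simp
  next
    fix y assume "y \<in> ?I #>\<^bsub>G\<^esub> x"
    then obtain z where z: "z \<in> carrier G" "y = displacement G \<psi> z \<otimes>\<^bsub>G\<^esub> x"
      by (auto simp: r_coset_def)
    then have y: "y \<in> carrier G" "y = z \<otimes>\<^bsub>G\<^esub> x \<otimes>\<^bsub>G\<^esub> inv\<^bsub>G\<^esub> (\<psi> z)"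
      using x by (simp_all add: displacement_def m_ac)
    then have "x = inv\<^bsub>G\<^esub> z \<otimes>\<^bsub>G\<^esub> y \<otimes>\<^bsub>G\<^esub> inv\<^bsub>G\<^esub> (\<psi> (inv\<^bsub>G\<^esub> z))"
      using x z(1) move[of z "\<psi> z" x] by (simp add: m_ac)
    then show "y \<in> twisted_conj G \<psi> `` {x}"
      using x z(1) y(1) by (auto simp: twisted_conj_def intro!: bexI[of _ "inv\<^bsub>G\<^esub> z"])
  qed
  have "carrier G // twisted_conj G \<psi> = rcosets\<^bsub>G\<^esub> ?I"
    unfolding quotient_def RCOSETS_def by (rule SUP_cong) (simp_all add: cls)
  then have "Reidemeister_number G \<psi> * card ?I = order G"
    using lagrange[OF I] by (simp add: Reidemeister_number_def)
  moreover have "card (fixed_points G \<psi>) * card ?I = order G"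
    using card_kernel_mult_card_image[of G G "displacement G \<psi>"] kernel_displacement[of G \<psi>]
      D.homh assms by simp
  moreover have "card ?I \<noteq> 0"
    using assms(2) one_closed by auto
  ultimately show ?thesis by (metis mult_cancel2)
qed

text \<open>The members of \<open>auto G\<close> are extensional functions. Restriction to the carrier turns any isomorphism
  into such a member and keeps the fixed points, so extensionality can be forgotten.\<close>

lemma Reidemeister_spectrum_eq_card_fixed_points:
  assumes "comm_group G" "finite (carrier G)"
  shows "Reidemeister_spectrum G = {card (fixed_points G \<psi>) |\<psi>. \<psi> \<in> iso G G}"
proof (rule subset_antisym; rule subsetI)
  fix d assume "d \<in> Reidemeister_spectrum G"
  then obtain \<psi> where "\<psi> \<in> auto G" "d = Reidemeister_number G \<psi>"
    by (auto simp: Reidemeister_spectrum_def)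
  then show "d \<in> {card (fixed_points G \<psi>) |\<psi>. \<psi> \<in> iso G G}"
    using Reidemeister_number_eq_card_fixed_points assms
    by (auto simp: auto_def Bij_def iso_def)
next
  fix d assume "d \<in> {card (fixed_points G \<psi>) |\<psi>. \<psi> \<in> iso G G}"
  then obtain \<psi> where \<psi>: "\<psi> \<in> iso G G" "d = card (fixed_points G \<psi>)" by auto
  interpret comm_group G by fact
  let ?\<psi> = "restrict \<psi> (carrier G)"
  have hom: "?\<psi> \<in> hom G G"
    using \<psi> by (auto simp: iso_def hom_def)
  then have "?\<psi> \<in> auto G"
    using \<psi> by (auto simp: auto_def Bij_def iso_def)
  moreover have "fixed_points G ?\<psi> = fixed_points G \<psi>"
    by (auto simp: fixed_points_def)
  ultimately show "d \<in> Reidemeister_spectrum G"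
    using Reidemeister_number_eq_card_fixed_points[OF assms hom] \<psi>(2)
    unfolding Reidemeister_spectrum_def by (metis (mono_tags, lifting) mem_Collect_eq)
qed

lemma card_fixed_points_in_spectrum:
  assumes "comm_group G" "finite (carrier G)" "\<psi> \<in> iso G G"
  shows "card (fixed_points G \<psi>) \<in> Reidemeister_spectrum G"
  using assms Reidemeister_spectrum_eq_card_fixed_points by blast

lemma finite_endo_isoI:
  assumes "group G" "finite (carrier G)" "\<psi> \<in> hom G G"
    and "\<And>x. \<lbrakk>x \<in> carrier G; \<psi> x = \<one>\<^bsub>G\<^esub>\<rbrakk> \<Longrightarrow> x = \<one>\<^bsub>G\<^esub>"
  shows "\<psi> \<in> iso G G"
proof -
  interpret group_hom G G \<psi> using assms by (simp add: group_hom_def group_hom_axioms_def)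
  have "inj_on \<psi> (carrier G)" using assms(4) by (simp add: inj_on_one_iff)
  moreover from this have "\<psi> ` carrier G = carrier G"
    by (rule endo_inj_surj[OF assms(2) hom_carrier[OF assms(3)]])
  ultimately show ?thesis
    using assms(3) by (simp add: iso_def bij_betw_def)
qed

text \<open>Conjugation by an isomorphism carries automorphisms to automorphisms and fixed points to fixed
  points.\<close>

lemma spectrum_iso_subset:
  assumes "comm_group G" "comm_group H" "finite (carrier G)" "G \<cong> H"
  shows "Reidemeister_spectrum G \<subseteq> Reidemeister_spectrum H"
proof
  interpret G: comm_group G by fact
  interpret H: comm_group H by fact
  fix d assume "d \<in> Reidemeister_spectrum G"
  then obtain \<psi> where \<psi>: "\<psi> \<in> iso G G" and d: "d = card (fixed_points G \<psi>)"
    using assms Reidemeister_spectrum_eq_card_fixed_points by blast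
  obtain f g where fg: "group_isomorphisms G H f g"
    using \<open>G \<cong> H\<close> by (auto simp: is_iso_def G.iso_iff_group_isomorphisms)
  then have f: "f \<in> iso G H" and g: "g \<in> iso H G"
    using group_isomorphisms_imp_iso group_isomorphisms_sym by blast+
  let ?\<phi> = "f \<circ> \<psi> \<circ> g"
  have \<phi>: "?\<phi> \<in> iso H H"
    using iso_set_trans[OF iso_set_trans[OF g \<psi>] f] by (simp add: comp_assoc)
  have finH: "finite (carrier H)" using assms iso_finite by blast
  have clos: "\<And>x. x \<in> carrier G \<Longrightarrow> \<psi> x \<in> carrier G" "\<And>x. x \<in> carrier G \<Longrightarrow> f x \<in> carrier H"
    "\<And>y. y \<in> carrier H \<Longrightarrow> g y \<in> carrier G"
    using \<psi> f g by (auto simp: iso_def intro: hom_in_carrier)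
  have inv: "\<And>x. x \<in> carrier G \<Longrightarrow> g (f x) = x" "\<And>y. y \<in> carrier H \<Longrightarrow> f (g y) = y"
    using fg by (auto simp: group_isomorphisms_def)
  have "bij_betw f (fixed_points G \<psi>) (fixed_points H ?\<phi>)"
    by (rule bij_betwI[where g = g])
      (use clos inv in \<open>force simp: fixed_points_def\<close>)+
  then have "d = card (fixed_points H ?\<phi>)" using d bij_betw_same_card by blast
  then show "d \<in> Reidemeister_spectrum H"
    using card_fixed_points_in_spectrum[OF assms(2) finH \<phi>] by simp
qed

lemma spectrum_iso:
  assumes "comm_group G" "comm_group H" "finite (carrier G)" "G \<cong> H"
  shows "Reidemeister_spectrum G = Reidemeister_spectrum H"
proof -
  have "H \<cong> G" using assms by (simp add: group.iso_sym comm_group_def)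
  then show ?thesis
    using assms spectrum_iso_subset[of G H] spectrum_iso_subset[of H G] iso_finite[of G H] by blast
qed

lemma DirProd_comm_group:
  assumes "comm_group G" "comm_group H"
  shows "comm_group (G \<times>\<times> H)"
proof -
  interpret G: comm_group G by fact
  interpret H: comm_group H by fact
  show ?thesis
    by (rule group.group_comm_groupI[OF DirProd_group])
      (auto simp: G.m_comm H.m_comm)
qed

text \<open>The fixed points of a product of automorphisms are the pairs of fixed points.\<close>

lemma spectrum_DirProd:
  assumes "comm_group G" "comm_group H" "finite (carrier G)" "finite (carrier H)"
    and "c \<in> Reidemeister_spectrum G" "d \<in> Reidemeister_spectrum H"
  shows "c * d \<in> Reidemeister_spectrum (G \<times>\<times> H)"
proof -
  obtain \<psi> \<phi> where \<psi>: "\<psi> \<in> iso G G" "c = card (fixed_points G \<psi>)"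
    and \<phi>: "\<phi> \<in> iso H H" "d = card (fixed_points H \<phi>)"
    using assms by (auto simp: Reidemeister_spectrum_eq_card_fixed_points)
  let ?f = "\<lambda>(x, y). (\<psi> x, \<phi> y)"
  have "?f \<in> iso (G \<times>\<times> H) (G \<times>\<times> H)"
    using \<psi> \<phi> assms by (simp add: iso_paired2 comm_group_def)
  moreover have "fixed_points (G \<times>\<times> H) ?f = fixed_points G \<psi> \<times> fixed_points H \<phi>"
    by (auto simp: fixed_points_def)
  ultimately show ?thesis
    using card_fixed_points_in_spectrum[of "G \<times>\<times> H" ?f] \<psi> \<phi> assms
    by (simp add: DirProd_comm_group card_cartesian_product)
qed

section \<open>Automorphisms of cyclic groups and of powers of a group\<close>

text \<open>Squaring is injective in odd order, since \<open>x\<close> is recovered from \<open>x\<^sup>2\<close> by raising to the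
  power \<open>(|G| + 1)/2\<close>, and \<open>x\<^sup>2 = x\<close> forces \<open>x = 1\<close>.\<close>

lemma one_in_spectrum_odd:
  assumes "comm_group G" "finite (carrier G)" "odd (order G)"
  shows "1 \<in> Reidemeister_spectrum G"
proof -
  interpret comm_group G by fact
  let ?\<psi> = "\<lambda>x. x \<otimes>\<^bsub>G\<^esub> x"
  have hom: "?\<psi> \<in> hom G G"
    by (rule homI) (simp_all add: m_ac)
  have "x = \<one>\<^bsub>G\<^esub>" if x: "x \<in> carrier G" "x \<otimes>\<^bsub>G\<^esub> x = \<one>\<^bsub>G\<^esub>" for x
  proof -
    obtain m where m: "order G = Suc (2 * m)"
      using assms(3) by (metis oddE Suc_eq_plus1)
    have "x [^]\<^bsub>G\<^esub> (2 * m) = (x [^]\<^bsub>G\<^esub> (2::nat)) [^]\<^bsub>G\<^esub> m"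
      using x(1) by (simp add: nat_pow_pow)
    also have "\<dots> = \<one>\<^bsub>G\<^esub>"
      using x by (simp add: numeral_2_eq_2)
    finally have "x [^]\<^bsub>G\<^esub> order G = x"
      using x(1) m by simp
    then show ?thesis using pow_order_eq_1 x(1) by simp
  qed
  then have "?\<psi> \<in> iso G G"
    using finite_endo_isoI[OF is_group assms(2) hom] by blast
  moreover have "fixed_points G ?\<psi> = {\<one>\<^bsub>G\<^esub>}"
    by (auto simp: fixed_points_def)
  ultimately show ?thesis
    using card_fixed_points_in_spectrum[OF assms(1,2), of ?\<psi>] by simp
qed

text \<open>The matrix of \<open>(x, y) \<mapsto> (y, x + y)\<close> has characteristic polynomial \<open>t\<^sup>2 - t - 1\<close>, whose values at
  0 and at 1 are both \<open>-1\<close>. So over every abelian group the map and its displacement are both invertible.\<close>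

lemma one_in_spectrum_square:
  assumes "comm_group G" "finite (carrier G)"
  shows "1 \<in> Reidemeister_spectrum (G \<times>\<times> G)"
proof -
  interpret comm_group G by fact
  let ?\<psi> = "\<lambda>(x, y). (y, x \<otimes>\<^bsub>G\<^esub> y)"
  have cg: "comm_group (G \<times>\<times> G)" by (intro DirProd_comm_group assms)
  have hom: "?\<psi> \<in> hom (G \<times>\<times> G) (G \<times>\<times> G)"
    by (rule homI) (auto simp: m_ac)
  have iso: "?\<psi> \<in> iso (G \<times>\<times> G) (G \<times>\<times> G)"
    by (rule finite_endo_isoI) (use cg assms hom in \<open>auto simp: comm_group_def\<close>)
  have fin: "finite (carrier (G \<times>\<times> G))" using assms by simp
  have "fixed_points (G \<times>\<times> G) ?\<psi> = {(\<one>\<^bsub>G\<^esub>, \<one>\<^bsub>G\<^esub>)}"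
    by (auto simp: fixed_points_def)
  then show ?thesis
    using card_fixed_points_in_spectrum[OF cg fin iso] by simp
qed

text \<open>As for the square, now with the polynomial \<open>t\<^sup>3 - t - 1\<close>. Squares and cubes together reach every
  power of \<open>G\<close> with exponent at least 2.\<close>

lemma one_in_spectrum_cube:
  assumes "comm_group G" "finite (carrier G)"
  shows "1 \<in> Reidemeister_spectrum (G \<times>\<times> G \<times>\<times> G)"
proof -
  interpret comm_group G by fact
  let ?\<psi> = "\<lambda>(x, y, z). (y, z, x \<otimes>\<^bsub>G\<^esub> y)"
  have cg: "comm_group (G \<times>\<times> G \<times>\<times> G)" by (intro DirProd_comm_group assms)
  have hom: "?\<psi> \<in> hom (G \<times>\<times> G \<times>\<times> G) (G \<times>\<times> G \<times>\<times> G)"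
    by (rule homI) (auto simp: m_ac)
  have iso: "?\<psi> \<in> iso (G \<times>\<times> G \<times>\<times> G) (G \<times>\<times> G \<times>\<times> G)"
    by (rule finite_endo_isoI) (use cg assms hom in \<open>auto simp: comm_group_def\<close>)
  have fin: "finite (carrier (G \<times>\<times> G \<times>\<times> G))" using assms by simp
  have "fixed_points (G \<times>\<times> G \<times>\<times> G) ?\<psi> = {(\<one>\<^bsub>G\<^esub>, \<one>\<^bsub>G\<^esub>, \<one>\<^bsub>G\<^esub>)}"
    by (auto simp: fixed_points_def)
  then show ?thesis
    using card_fixed_points_in_spectrum[OF cg fin iso] by simp
qed

lemma card_multiples:
  assumes "0 < a"
  shows "card {x \<in> {0..<int (a * b)}. int a dvd x} = b"
proof -
  have "{x \<in> {0..<int (a * b)}. int a dvd x} = (*) (int a) ` {0..<int b}"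
  proof (rule subset_antisym; rule subsetI)
    fix x assume "x \<in> {x \<in> {0..<int (a * b)}. int a dvd x}"
    then obtain y where y: "x = int a * y" "0 \<le> x" "x < int a * int b" by auto
    then have "0 \<le> y" "y < int b"
      using assms by (auto simp: zero_le_mult_iff mult_less_cancel_left)
    then show "x \<in> (*) (int a) ` {0..<int b}" using y by auto
  qed (use assms in \<open>auto simp: mult_less_cancel_left\<close>)
  moreover have "inj_on ((*) (int a)) {0..<int b}"
    using assms by (auto simp: inj_on_def)
  ultimately show ?thesis by (simp add: card_image)
qed

lemma carrier_integer_mod_group_power [simp]:
  "0 < p \<Longrightarrow> carrier (integer_mod_group (p ^ n)) = {0..<int p ^ n}"
  by (simp add: carrier_integer_mod_group)

text \<open>Multiplication by \<open>1 + p\<^sup>k\<close> is invertible because \<open>k \<ge> 1\<close>, and it fixes \<open>x\<close> exactly if \<open>p\<^sup>n\<close> divides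
  \<open>p\<^sup>k x\<close>.\<close>

lemma prime_power_in_spectrum_cyclic:
  fixes p k n :: nat
  assumes p: "prime p" and k: "1 \<le> k" "k \<le> n"
  shows "p ^ k \<in> Reidemeister_spectrum (integer_mod_group (p ^ n))"
proof -
  have p0: "0 < p" using p prime_gt_0_nat by blast
  let ?G = "integer_mod_group (p ^ n)"
  let ?m = "1 + int p ^ k"
  let ?\<psi> = "\<lambda>x. (?m * x) mod int p ^ n"
  have cg: "comm_group ?G" by simp
  have fin: "finite (carrier ?G)" using p0 by simp
  have hom: "?\<psi> \<in> hom ?G ?G"
  proof (rule homI)
    fix x y
    show "?\<psi> (x \<otimes>\<^bsub>?G\<^esub> y) = ?\<psi> x \<otimes>\<^bsub>?G\<^esub> ?\<psi> y"
      by (simp only: mult_integer_mod_group of_nat_power mod_mult_right_eq mod_add_eq distrib_left)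
  qed (use p0 in simp)
  have small: "x = 0" if "x \<in> {0..<int p ^ n}" "int p ^ n dvd x" for x
    using that zdvd_not_zless[of x "int p ^ n"] by (cases "0 < x") auto
  have "coprime (int p ^ k) ?m"
    using coprime_add_one_right[of "int p ^ k"] by (simp add: add.commute)
  then have "coprime (int p) ?m" using k by (simp add: coprime_power_left_iff)
  then have "coprime (int p ^ n) ?m" by simp
  then have "?\<psi> \<in> iso ?G ?G"
    using p0 small
    by (intro finite_endo_isoI[OF _ fin hom])
      (auto simp: mod_eq_0_iff_dvd coprime_dvd_mult_right_iff)
  moreover have "fixed_points ?G ?\<psi> = {x \<in> {0..<int (p ^ (n - k) * p ^ k)}. int (p ^ (n - k)) dvd x}"
  proof -
    have "?\<psi> x = x \<longleftrightarrow> int (p ^ (n - k)) dvd x" if x: "0 \<le> x" "x < int p ^ n" for x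
    proof -
      have "?\<psi> x = x \<longleftrightarrow> (?m * x) mod int p ^ n = x mod int p ^ n" using x by simp
      also have "\<dots> \<longleftrightarrow> int p ^ n dvd int p ^ k * x"
        by (simp add: mod_eq_dvd_iff algebra_simps)
      also have "\<dots> \<longleftrightarrow> int p ^ k * int p ^ (n - k) dvd int p ^ k * x"
        using k by (simp flip: power_add)
      also have "\<dots> \<longleftrightarrow> int p ^ (n - k) dvd x"
        using p0 by simp
      finally show ?thesis by simp
    qed
    moreover have "int (p ^ (n - k) * p ^ k) = int p ^ n"
      using k by (simp flip: power_add)
    ultimately show ?thesis
      using p0 by (auto simp: fixed_points_def)
  qed
  ultimately show ?thesis
    using card_fixed_points_in_spectrum[OF cg fin, of ?\<psi>] card_multiples[of "p ^ (n - k)" "p ^ k"] p0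
    by simp
qed

text \<open>The map \<open>(x, y) \<mapsto> (x + y, 2x + y)\<close> is well defined because \<open>2\<^sup>b\<close> divides \<open>2\<^sup>a\<^sup>+\<^sup>1\<close>, it is
  invertible because its determinant is \<open>-1\<close>, and its displacement \<open>(x, y) \<mapsto> (-y, -2x)\<close> has a
  kernel of order 2. Diagonal automorphisms have at least 4 fixed points on this group.\<close>

lemma two_in_spectrum_cyclic_pair:
  assumes a: "1 \<le> a" and b: "b = a \<or> b = Suc a"
  shows "2 \<in> Reidemeister_spectrum (integer_mod_group (2 ^ a) \<times>\<times> integer_mod_group (2 ^ b))"
proof -
  let ?A = "2 ^ a :: int" and ?B = "2 ^ b :: int"
  let ?G = "integer_mod_group (2 ^ a) \<times>\<times> integer_mod_group (2 ^ b)"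
  let ?\<psi> = "\<lambda>(x, y). ((x + y) mod ?A, (2 * x + y) mod ?B)"
  have cg: "comm_group ?G" by (simp add: DirProd_comm_group)
  have fin: "finite (carrier ?G)" by simp
  have AB: "?A dvd ?B" "?B dvd 2 * ?A" 
    using b by (auto simp: le_imp_power_dvd)
  \<comment> \<open>Inner reductions may be dropped; here \<open>a \<le> b \<le> a + 1\<close> enters.\<close>
  have red1: "(u mod ?A + v mod ?B) mod ?A = (u + v) mod ?A" for u v
  proof -
    have "(u mod ?A + v mod ?B) mod ?A = (u mod ?A mod ?A + v mod ?B mod ?A) mod ?A"
      by (simp only: mod_add_eq)
    also have "\<dots> = (u + v) mod ?A"
      by (simp only: mod_mod_cancel[OF AB(1)] mod_mod_trivial mod_add_eq)
    finally show ?thesis .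
  qed
  have red2: "(2 * (u mod ?A) + v mod ?B) mod ?B = (2 * u + v) mod ?B" for u v
  proof -
    have "2 * (u mod ?A) mod ?B = (2 * u) mod (2 * ?A) mod ?B" by (simp only: mult_mod_right)
    also have "\<dots> = (2 * u) mod ?B" using AB(2) by (rule mod_mod_cancel)
    finally have double: "2 * (u mod ?A) mod ?B = (2 * u) mod ?B" .
    have "(2 * (u mod ?A) + v mod ?B) mod ?B = (2 * (u mod ?A) mod ?B + v mod ?B mod ?B) mod ?B"
      by (simp only: mod_add_eq)
    also have "\<dots> = (2 * u + v) mod ?B"
      by (simp only: double mod_mod_trivial mod_add_eq)
    finally show ?thesis .
  qed
  have hom: "?\<psi> \<in> hom ?G ?G"
  proof (rule homI)
    fix x y
    assume "x \<in> carrier ?G" "y \<in> carrier ?G"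
    obtain x1 x2 y1 y2 where xy: "x = (x1, x2)" "y = (y1, y2)" by (metis surj_pair)
    show "?\<psi> (x \<otimes>\<^bsub>?G\<^esub> y) = ?\<psi> x \<otimes>\<^bsub>?G\<^esub> ?\<psi> y"
      by (simp add: xy red1 red2 mod_add_eq) (simp add: algebra_simps)
  qed auto
  have small: "x = 0" if "0 \<le> x" "x < 2 ^ n" "2 ^ n dvd x" for x :: int and n
    using that zdvd_not_zless[of x "2 ^ n"] by (cases "0 < x") auto
  have "(x, y) = (0, 0)"
    if xy: "0 \<le> x" "x < ?A" "0 \<le> y" "y < ?B" and z: "?A dvd x + y" "?B dvd 2 * x + y" for x y
  proof -
    have "?A dvd (2 * x + y) - (x + y)"
      using z AB(1) by (meson dvd_diff dvd_trans)
    then have "x = 0" using xy small by simp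
    then show ?thesis using xy z small by simp
  qed
  then have iso: "?\<psi> \<in> iso ?G ?G"
    by (intro finite_endo_isoI[OF _ fin hom])
      (use cg in \<open>auto simp: comm_group_def mod_eq_0_iff_dvd\<close>)
  have fix_iff: "(x + y) mod ?A = x \<and> (2 * x + y) mod ?B = y \<longleftrightarrow> ?A dvd y \<and> ?B dvd 2 * x"
    if xy: "0 \<le> x" "x < ?A" "0 \<le> y" "y < ?B" for x y
  proof -
    have "(x + y) mod ?A = x \<and> (2 * x + y) mod ?B = y \<longleftrightarrow> (x + y) mod ?A = x mod ?A \<and> (2 * x + y) mod ?B = y mod ?B"
      using xy by simp
    then show ?thesis by (simp only: mod_eq_dvd_iff) simp
  qed
  obtain c where c: "a = Suc c" using a by (cases a) auto
  have half: "x = 0 \<or> x = 2 ^ n" if x: "0 \<le> x" "x < 2 * 2 ^ n" "2 ^ n dvd x" for x :: int and n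
  proof -
    obtain q where "x = 2 ^ n * q" using x by blast
    then have "0 \<le> q" "q < 2" using x by (auto simp: zero_le_mult_iff)
    then have "q = 0 \<or> q = 1" by auto
    then show ?thesis using \<open>x = 2 ^ n * q\<close> by auto
  qed
  have fixed: "fixed_points ?G ?\<psi> =
    {(x, y). 0 \<le> x \<and> x < ?A \<and> 0 \<le> y \<and> y < ?B \<and> ?A dvd y \<and> ?B dvd 2 * x}"
  proof -
    have "fixed_points ?G ?\<psi> = {(x, y). (0 \<le> x \<and> x < ?A \<and> 0 \<le> y \<and> y < ?B)
      \<and> ((x + y) mod ?A = x \<and> (2 * x + y) mod ?B = y)}"
      by (auto simp: fixed_points_def)
    then show ?thesis using fix_iff by blast
  qed
  have "card (fixed_points ?G ?\<psi>) = 2"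
  proof (cases "b = a")
    case True
    then have "fixed_points ?G ?\<psi> = {(0, 0), (2 ^ c, 0)}"
      using c small[of _ a] half[of _ c] unfolding fixed by auto
    then show ?thesis by simp
  next
    case False
    then have "fixed_points ?G ?\<psi> = {(0, 0), (0, 2 ^ a)}"
      using b small[of _ a] half[of _ a] unfolding fixed by auto
    then show ?thesis by simp
  qed
  then show ?thesis using card_fixed_points_in_spectrum[OF cg fin iso] by simp
qed

section \<open>Sums of cyclic 2-groups\<close>

lemma carrier_sum_group_finite:
  assumes "finite I" "\<And>i. i \<in> I \<Longrightarrow> group (G i)"
  shows "carrier (sum_group I G) = (\<Pi>\<^sub>E i\<in>I. carrier (G i))"
  using assms by (simp add: carrier_sum_group)

lemma comm_group_sum_group:
  assumes "\<And>i. i \<in> I \<Longrightarrow> comm_group (G i)"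
  shows "comm_group (sum_group I G)"
proof (rule group.group_comm_groupI)
  show "group (sum_group I G)"
    using assms by (simp add: comm_group_def)
  fix x y assume "x \<in> carrier (sum_group I G)" "y \<in> carrier (sum_group I G)"
  then show "x \<otimes>\<^bsub>sum_group I G\<^esub> y = y \<otimes>\<^bsub>sum_group I G\<^esub> x"
    using assms
    by (auto simp: carrier_sum_group comm_group_def PiE_iff intro!: restrict_ext comm_monoid.m_comm)
qed

text \<open>A partition of the index set splits the sum; this is how the blocks are treated separately.\<close>

lemma sum_group_Un_iso:
  assumes fin: "finite I" "finite J" and disj: "I \<inter> J = {}"
    and G: "\<And>i. i \<in> I \<union> J \<Longrightarrow> group (G i)"
  shows "sum_group (I \<union> J) G \<cong> sum_group I G \<times>\<times> sum_group J G"
proof (rule is_isoI, rule isoI)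
  let ?f = "\<lambda>x. (restrict x I, restrict x J)"
  have c: "carrier (sum_group (I \<union> J) G) = (\<Pi>\<^sub>E i\<in>I \<union> J. carrier (G i))"
    "carrier (sum_group I G) = (\<Pi>\<^sub>E i\<in>I. carrier (G i))"
    "carrier (sum_group J G) = (\<Pi>\<^sub>E i\<in>J. carrier (G i))"
    by (rule carrier_sum_group_finite; use fin G in simp)+
  show "?f \<in> hom (sum_group (I \<union> J) G) (sum_group I G \<times>\<times> sum_group J G)"
    by (rule homI) (auto simp: c)
  show "bij_betw ?f (carrier (sum_group (I \<union> J) G)) (carrier (sum_group I G \<times>\<times> sum_group J G))"
    unfolding carrier_DirProd c
  proof (rule bij_betwI[where g = "\<lambda>(x, y) i. if i \<in> I then x i else y i"])
    show "?f \<in> (\<Pi>\<^sub>E i\<in>I \<union> J. carrier (G i)) \<rightarrow> (\<Pi>\<^sub>E i\<in>I. carrier (G i)) \<times> (\<Pi>\<^sub>E i\<in>J. carrier (G i))"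
      by auto
    show "(\<lambda>(x, y) i. if i \<in> I then x i else y i)
      \<in> (\<Pi>\<^sub>E i\<in>I. carrier (G i)) \<times> (\<Pi>\<^sub>E i\<in>J. carrier (G i)) \<rightarrow> (\<Pi>\<^sub>E i\<in>I \<union> J. carrier (G i))"
      by (auto simp: PiE_iff extensional_def)
    show "(\<lambda>(x, y) i. if i \<in> I then x i else y i) (?f x) = x"
      if "x \<in> (\<Pi>\<^sub>E i\<in>I \<union> J. carrier (G i))" for x
      using that by (auto simp: PiE_iff extensional_def fun_eq_iff)
    show "?f ((\<lambda>(x, y) i. if i \<in> I then x i else y i) z) = z"
      if "z \<in> (\<Pi>\<^sub>E i\<in>I. carrier (G i)) \<times> (\<Pi>\<^sub>E i\<in>J. carrier (G i))" for z
      using that disj by (auto simp: PiE_iff extensional_def fun_eq_iff)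
  qed
qed

lemma sum_group_singleton_iso:
  assumes "group (G i)"
  shows "sum_group {i} G \<cong> G i"
proof (rule is_isoI, rule isoI)
  have c: "carrier (sum_group {i} G) = (\<Pi>\<^sub>E j\<in>{i}. carrier (G j))"
    by (rule carrier_sum_group_finite) (use assms in auto)
  show "(\<lambda>x. x i) \<in> hom (sum_group {i} G) (G i)"
    by (rule homI) (auto simp: c)
  show "bij_betw (\<lambda>x. x i) (carrier (sum_group {i} G)) (carrier (G i))"
    unfolding c
    by (rule bij_betwI[where g = "\<lambda>a. \<lambda>j\<in>{i}. a"]) (auto simp: PiE_iff extensional_def fun_eq_iff)
qed

text \<open>With \<open>I = {..<length e}\<close> and \<open>(!) e\<close> this is the 2-group of type \<open>e\<close>. General index sets are
  allowed so that the block with positions \<open>X\<close> is the group over \<open>X\<close> with the same exponent function.\<close>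

definition two_group :: "nat set \<Rightarrow> (nat \<Rightarrow> nat) \<Rightarrow> (nat \<Rightarrow> int) monoid" where
  "two_group I e = sum_group I (\<lambda>i. integer_mod_group (2 ^ e i))"

lemma carrier_two_group:
  assumes "finite I"
  shows "carrier (two_group I e) = (\<Pi>\<^sub>E i\<in>I. {0..<2 ^ e i})"
proof -
  have "carrier (two_group I e) = (\<Pi>\<^sub>E i\<in>I. carrier (integer_mod_group (2 ^ e i)))"
    unfolding two_group_def by (rule carrier_sum_group_finite) (use assms in auto)
  then show ?thesis by simp
qed

lemma two_group_facts [simp]:
  "comm_group (two_group I e)" "group (two_group I e)" "finite I \<Longrightarrow> finite (carrier (two_group I e))"
proof -
  show "comm_group (two_group I e)"
    unfolding two_group_def by (intro comm_group_sum_group) simp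
  then show "group (two_group I e)" by (simp add: comm_group_def)
  show "finite (carrier (two_group I e))" if "finite I"
    using that by (simp add: carrier_two_group finite_PiE)
qed

lemma spectrum_two_group_Un:
  assumes "finite I" "finite J" "I \<inter> J = {}"
  shows "Reidemeister_spectrum (two_group (I \<union> J) e)
    = Reidemeister_spectrum (two_group I e \<times>\<times> two_group J e)"
proof (rule spectrum_iso)
  show "two_group (I \<union> J) e \<cong> two_group I e \<times>\<times> two_group J e"
    unfolding two_group_def by (rule sum_group_Un_iso) (use assms in auto)
qed (use assms in \<open>auto intro!: DirProd_comm_group\<close>)

lemma two_group_singleton_iso: "two_group {i} e \<cong> integer_mod_group (2 ^ e i)"
  unfolding two_group_def by (rule sum_group_singleton_iso) simp

lemma spectrum_two_group_singleton:
  "Reidemeister_spectrum (two_group {i} e) = Reidemeister_spectrum (integer_mod_group (2 ^ e i))"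
  by (intro spectrum_iso two_group_singleton_iso) simp_all

lemma two_group_pair_iso:
  assumes "i \<noteq> j"
  shows "two_group {i, j} e \<cong> integer_mod_group (2 ^ e i) \<times>\<times> integer_mod_group (2 ^ e j)"
proof -
  have "two_group ({i} \<union> {j}) e \<cong> two_group {i} e \<times>\<times> two_group {j} e"
    unfolding two_group_def by (rule sum_group_Un_iso) (use assms in auto)
  also have "\<dots> \<cong> integer_mod_group (2 ^ e i) \<times>\<times> integer_mod_group (2 ^ e j)"
    by (intro group.DirProd_iso_trans two_group_singleton_iso) auto
  finally show ?thesis by (simp add: insert_commute)
qed

definition realizes_from :: "nat \<Rightarrow> nat set \<Rightarrow> (nat \<Rightarrow> nat) \<Rightarrow> bool" where
  "realizes_from l I e \<longleftrightarrow>
    (\<forall>k. l \<le> k \<and> k \<le> (\<Sum>i\<in>I. e i) \<longrightarrow> 2 ^ k \<in> Reidemeister_spectrum (two_group I e))"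

text \<open>The sum of the two intervals of realizable exponents is again an interval. The bounds on \<open>l\<close> and
  \<open>m\<close> ensure that both intervals are nonempty.\<close>

lemma realizes_from_Un:
  assumes fin: "finite I" "finite J" and disj: "I \<inter> J = {}"
    and I: "realizes_from l I e" "l \<le> (\<Sum>i\<in>I. e i)"
    and J: "realizes_from m J e" "m \<le> (\<Sum>i\<in>J. e i)"
  shows "realizes_from (l + m) (I \<union> J) e"
  unfolding realizes_from_def
proof (intro allI impI)
  fix k assume k: "l + m \<le> k \<and> k \<le> (\<Sum>i\<in>I \<union> J. e i)"
  then have "k \<le> (\<Sum>i\<in>I. e i) + (\<Sum>i\<in>J. e i)" using fin disj by (simp add: sum.union_disjoint)
  \<comment> \<open>Use only the minimum \<open>m\<close> on \<open>J\<close> as long as \<open>I\<close> can supply the rest.\<close>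
  then obtain a b where ab: "k = a + b" "l \<le> a" "a \<le> (\<Sum>i\<in>I. e i)" "m \<le> b" "b \<le> (\<Sum>i\<in>J. e i)"
  proof (cases "k - m \<le> (\<Sum>i\<in>I. e i)")
    case True
    then show ?thesis using k J(2) by (intro that[of "k - m" m]) auto
  next
    case False
    then show ?thesis using k I(2) \<open>k \<le> _ + _\<close>
      by (intro that[of "\<Sum>i\<in>I. e i" "k - (\<Sum>i\<in>I. e i)"]) auto
  qed
  then have "2 ^ a * 2 ^ b \<in> Reidemeister_spectrum (two_group I e \<times>\<times> two_group J e)"
    using I J fin by (intro spectrum_DirProd) (auto simp: realizes_from_def)
  then show "2 ^ k \<in> Reidemeister_spectrum (two_group (I \<union> J) e)"
    using ab fin disj by (simp add: spectrum_two_group_Un power_add)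
qed

lemma realizes_from_singleton: "realizes_from 1 {i} e"
  unfolding realizes_from_def spectrum_two_group_singleton
  using prime_power_in_spectrum_cyclic[of 2] by auto

lemma realizes_from_extend:
  assumes "realizes_from (Suc l) I e" "2 ^ l \<in> Reidemeister_spectrum (two_group I e)"
  shows "realizes_from l I e"
  using assms unfolding realizes_from_def by (metis le_antisym not_less_eq_eq)

text \<open>Diagonal automorphisms give all exponents except 1.\<close>

lemma realizes_from_pair:
  assumes "i \<noteq> j" "1 \<le> e i" "e j = e i \<or> e j = Suc (e i)"
  shows "realizes_from 1 {i, j} e"
proof (rule realizes_from_extend)
  show "realizes_from (Suc 1) {i, j} e"
    using realizes_from_Un[of "{i}" "{j}" 1 e 1] realizes_from_singleton assms
    by (auto simp: insert_commute)
  have "2 \<in> Reidemeister_spectrum (integer_mod_group (2 ^ e i) \<times>\<times> integer_mod_group (2 ^ e j))"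
    using assms by (intro two_in_spectrum_cyclic_pair)
  also have "\<dots> = Reidemeister_spectrum (two_group {i, j} e)"
    using assms by (intro spectrum_iso[symmetric] two_group_pair_iso) (auto intro!: DirProd_comm_group)
  finally show "2 ^ 1 \<in> Reidemeister_spectrum (two_group {i, j} e)" by simp
qed

lemma realizes_from_equal_pair:
  assumes "i \<noteq> j" "1 \<le> e i" "e j = e i"
  shows "realizes_from 0 {i, j} e"
proof (rule realizes_from_extend)
  show "realizes_from (Suc 0) {i, j} e"
    using realizes_from_pair[of i j e] assms by simp
  have "1 \<in> Reidemeister_spectrum (integer_mod_group (2 ^ e i) \<times>\<times> integer_mod_group (2 ^ e j))"
    using assms one_in_spectrum_square[of "integer_mod_group (2 ^ e i)"] by simp
  also have "\<dots> = Reidemeister_spectrum (two_group {i, j} e)"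
    using assms by (intro spectrum_iso[symmetric] two_group_pair_iso) (auto intro!: DirProd_comm_group)
  finally show "2 ^ 0 \<in> Reidemeister_spectrum (two_group {i, j} e)" by simp
qed

lemma realizes_from_equal_triple:
  assumes "distinct [i, j, k]" "1 \<le> e i" "e j = e i" "e k = e i"
  shows "realizes_from 0 {i, j, k} e"
proof (rule realizes_from_extend)
  have "realizes_from (1 + 0) ({i} \<union> {j, k}) e"
    using realizes_from_singleton[of i e] realizes_from_equal_pair[of j k e] assms
    by (intro realizes_from_Un) auto
  then show "realizes_from (Suc 0) {i, j, k} e" by (simp add: insert_commute)
  let ?C = "integer_mod_group (2 ^ e i)"
  have "two_group ({i} \<union> {j, k}) e \<cong> two_group {i} e \<times>\<times> two_group {j, k} e"
    unfolding two_group_def by (rule sum_group_Un_iso) (use assms in auto)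
  also have "\<dots> \<cong> ?C \<times>\<times> ?C \<times>\<times> ?C"
    using two_group_singleton_iso[of i e] two_group_pair_iso[of j k e] assms
    by (intro group.DirProd_iso_trans) simp_all
  finally have "two_group {i, j, k} e \<cong> ?C \<times>\<times> ?C \<times>\<times> ?C" by (simp add: insert_commute)
  then have "Reidemeister_spectrum (two_group {i, j, k} e) = Reidemeister_spectrum (?C \<times>\<times> ?C \<times>\<times> ?C)"
    by (intro spectrum_iso DirProd_comm_group) auto
  then show "2 ^ 0 \<in> Reidemeister_spectrum (two_group {i, j, k} e)"
    using one_in_spectrum_cube[of ?C] by simp
qed

text \<open>Split off equal pairs until two or three summands are left.\<close>

lemma realizes_from_constant:
  assumes "finite I" "2 \<le> card I" "\<And>i. i \<in> I \<Longrightarrow> e i = v" "1 \<le> v"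
  shows "realizes_from 0 I e"
  using assms
proof (induction "card I" arbitrary: I rule: less_induct)
  case less
  obtain i j where ij: "i \<in> I" "j \<in> I" "i \<noteq> j"
    using less.prems(2) by (metis card_le_Suc0_iff_eq less.prems(1) not_less_eq_eq numeral_2_eq_2)
  have pair: "realizes_from 0 {i, j} e"
    using ij less.prems by (intro realizes_from_equal_pair) auto
  have split: "I = {i, j} \<union> (I - {i, j})" using ij by auto
  have c: "card (I - {i, j}) = card I - 2"
    using ij less.prems(1) by (simp add: card_Diff_subset)
  consider "card I = 2" | "card I = 3" | "4 \<le> card I" using less.prems(2) by linarith
  then show ?case
  proof cases
    case 1
    then have "card (I - {i, j}) = 0" using c by simp
    then have "I - {i, j} = {}" using less.prems(1) by (metis card_0_eq finite_Diff)
    then have "I = {i, j}" using ij by auto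
    then show ?thesis using pair by simp
  next
    case 2
    \<comment> \<open>A summand split off on its own would cost a factor 2, so three are treated at once.\<close>
    then have "card (I - {i, j}) = 1" using c by simp
    then obtain k where k: "I - {i, j} = {k}" by (rule card_1_singletonE)
    then have "I = {i, j, k}" "k \<in> I" "k \<notin> {i, j}" using split by auto
    then show ?thesis using ij less.prems realizes_from_equal_triple[of i j k e] by auto
  next
    case 3
    then have "realizes_from 0 (I - {i, j}) e"
      using c less.prems by (intro less.hyps) auto
    then have "realizes_from (0 + 0) ({i, j} \<union> (I - {i, j})) e"
      using pair less.prems(1) by (intro realizes_from_Un) auto
    then show ?thesis using split by simp
  qed
qed

lemma realizes_from_Union:
  assumes "finite \<B>" "pairwise disjnt \<B>"
    and "\<And>X. X \<in> \<B> \<Longrightarrow> finite X"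
    and "\<And>X. X \<in> \<B> \<Longrightarrow> realizes_from (l X) X e \<and> l X \<le> (\<Sum>i\<in>X. e i)"
  shows "realizes_from (\<Sum>X\<in>\<B>. l X) (\<Union>\<B>) e \<and> (\<Sum>X\<in>\<B>. l X) \<le> (\<Sum>i\<in>\<Union>\<B>. e i)"
  using assms
proof (induction \<B> rule: finite_induct)
  case empty
  have "fixed_points (two_group {} e) id = {\<lambda>i. undefined}"
    by (auto simp: fixed_points_def carrier_two_group)
  then show ?case
    using card_fixed_points_in_spectrum[of "two_group {} e" id] id_iso
    by (auto simp: realizes_from_def)
next
  case (insert X \<B>)
  then have pw: "pairwise disjnt \<B>" by (simp add: pairwise_insert)
  have "disjnt X Y" if "Y \<in> \<B>" for Y
    using that insert.hyps insert.prems(1) by (auto simp: pairwise_insert)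
  then have disj: "X \<inter> \<Union>\<B> = {}" by (auto simp: disjnt_def)
  have fin: "finite X" "finite (\<Union>\<B>)" using insert by auto
  have IH: "realizes_from (\<Sum>X\<in>\<B>. l X) (\<Union>\<B>) e" "(\<Sum>X\<in>\<B>. l X) \<le> (\<Sum>i\<in>\<Union>\<B>. e i)"
    using insert.IH pw insert.prems by auto
  have X: "realizes_from (l X) X e" "l X \<le> (\<Sum>i\<in>X. e i)" using insert.prems by auto
  have "realizes_from (l X + (\<Sum>X\<in>\<B>. l X)) (X \<union> \<Union>\<B>) e"
    by (rule realizes_from_Un[OF fin disj X IH])
  then show ?case
    using insert.hyps fin disj X IH by (auto simp: sum.union_disjoint)
qed

section \<open>The abc-decomposition\<close>

lemma b_start_candidate: "b_start e i \<Longrightarrow> b_candidate e i"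
  by (cases i) auto

lemma b_start_not_Suc: "b_start e i \<Longrightarrow> \<not> b_start e (Suc i)"
  by simp

lemma a_blocks_subset: "X \<in> a_blocks e \<Longrightarrow> X \<subseteq> {..<length e}"
  by (auto simp: a_blocks_def)

text \<open>Two runs with a common position carry the same value, so maximality of the second one keeps the first
  from reaching beyond either of its ends. By symmetry, intersecting a-blocks are equal.\<close>

lemma a_blocks_disjoint:
  assumes "X \<in> a_blocks e" "Y \<in> a_blocks e" "k \<in> X" "k \<in> Y"
  shows "X \<subseteq> Y"
proof -
  obtain i j where X: "X = {i..<j}" "j \<le> length e" "\<forall>k\<in>{i..<j}. e ! k = e ! i"
    using assms(1) by (auto simp: a_blocks_def)
  obtain i' j' where Y: "Y = {i'..<j'}" "\<forall>k\<in>{i'..<j'}. e ! k = e ! i'"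
    "i' = 0 \<or> e ! (i' - 1) \<noteq> e ! i'" "j' = length e \<or> e ! j' \<noteq> e ! i'"
    using assms(2) by (auto simp: a_blocks_def)
  have k: "i \<le> k" "k < j" "i' \<le> k" "k < j'" using assms(3,4) X(1) Y(1) by auto
  have "e ! k = e ! i" "e ! k = e ! i'" using bspec[OF X(3), of k] bspec[OF Y(2), of k] k by auto
  then have same: "e ! i = e ! i'" by simp
  have "i' \<le> i"
  proof (rule ccontr)
    assume "\<not> i' \<le> i"
    then have "i' - 1 \<in> {i..<j}" using k by auto
    then show False using bspec[OF X(3), of "i' - 1"] Y(3) same \<open>\<not> i' \<le> i\<close> by auto
  qed
  moreover have "j \<le> j'"
  proof (rule ccontr)
    assume "\<not> j \<le> j'"
    then have "j' \<in> {i..<j}" using k by auto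
    then show False using bspec[OF X(3), of j'] X(2) Y(4) same \<open>\<not> j \<le> j'\<close> by auto
  qed
  ultimately show ?thesis using X(1) Y(1) by auto
qed

lemma b_blocks_disjoint_a_blocks: "\<Union>(b_blocks e) \<inter> \<Union>(a_blocks e) = {}"
  by (auto simp: b_blocks_def b_candidate_def dest!: b_start_candidate)

lemma c_blocks_disjoint: "\<Union>(c_blocks e) \<inter> (\<Union>(a_blocks e) \<union> \<Union>(b_blocks e)) = {}"
  by (auto simp: c_blocks_def)

lemma pairwise_disjnt_blocks: "pairwise disjnt (a_blocks e \<union> b_blocks e \<union> c_blocks e)"
proof -
  have "X = Y"
    if "X \<in> a_blocks e \<union> b_blocks e \<union> c_blocks e" "Y \<in> a_blocks e \<union> b_blocks e \<union> c_blocks e"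
      and k: "k \<in> X" "k \<in> Y" for X Y k
  proof -
    have "X \<in> a_blocks e \<and> Y \<in> a_blocks e \<or> X \<in> b_blocks e \<and> Y \<in> b_blocks e
      \<or> X \<in> c_blocks e \<and> Y \<in> c_blocks e"
      using that b_blocks_disjoint_a_blocks[of e] c_blocks_disjoint[of e] by blast
    then consider "X \<in> a_blocks e" "Y \<in> a_blocks e" | "X \<in> b_blocks e" "Y \<in> b_blocks e"
      | "X \<in> c_blocks e" "Y \<in> c_blocks e" by blast
    then show ?thesis
    proof cases
      case 1
      then show ?thesis using a_blocks_disjoint k by (metis subset_antisym)
    next
      case 2
      then obtain i j where "X = {i, Suc i}" "b_start e i" "Y = {j, Suc j}" "b_start e j"
        by (auto simp: b_blocks_def)
      then show ?thesis using k b_start_not_Suc by auto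
    next
      case 3
      then show ?thesis using k by (auto simp: c_blocks_def)
    qed
  qed
  then show ?thesis by (auto simp: pairwise_def disjnt_iff)
qed

lemma Union_blocks: "\<Union>(a_blocks e \<union> b_blocks e \<union> c_blocks e) = {..<length e}"
proof -
  have "\<Union>(b_blocks e) \<subseteq> {..<length e}"
    by (auto simp: b_blocks_def b_candidate_def dest!: b_start_candidate)
  moreover have "\<Union>(a_blocks e) \<subseteq> {..<length e}" using a_blocks_subset by blast
  moreover have "\<Union>(c_blocks e) = {..<length e} - \<Union>(a_blocks e) - \<Union>(b_blocks e)"
    unfolding c_blocks_def by blast
  ultimately show ?thesis by auto
qed

lemma finite_blocks: "finite (a_blocks e \<union> b_blocks e \<union> c_blocks e)"
proof (rule finite_subset)
  show "a_blocks e \<union> b_blocks e \<union> c_blocks e \<subseteq> Pow {..<length e}"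
    using Union_blocks[of e] by blast
qed simp

text \<open>The blocks partition the positions. An a-block realizes all exponents from 0 on, a b-block or c-block
  all exponents from 1 on, and these lower bounds add up to \<open>b(e) + c(e)\<close>.\<close>

lemma realizes_from_type:
  assumes e: "\<forall>x\<in>set e. 1 \<le> x"
  shows "realizes_from (num_b e + num_c e) {..<length e} ((!) e)"
proof -
  let ?\<B> = "a_blocks e \<union> b_blocks e \<union> c_blocks e"
  let ?l = "\<lambda>X. if X \<in> a_blocks e then 0 else 1 :: nat"
  have pos: "1 \<le> e ! i" if "i < length e" for i using e that by simp
  have X: "realizes_from (?l X) X ((!) e) \<and> ?l X \<le> (\<Sum>i\<in>X. e ! i)" if "X \<in> ?\<B>" for X
  proof (cases "X \<in> a_blocks e")
    case True
    then obtain i j where X: "X = {i..<j}" "i + 2 \<le> j" "j \<le> length e" "\<forall>k\<in>{i..<j}. e ! k = e ! i"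
      by (auto simp: a_blocks_def)
    have "realizes_from 0 X ((!) e)"
    proof (rule realizes_from_constant)
      show "e ! k = e ! i" if "k \<in> X" for k
        using that X(1) bspec[OF X(4), of k] by simp
    qed (use X(1-3) pos in auto)
    then show ?thesis using True by simp
  next
    case False
    then consider "X \<in> b_blocks e" | "X \<in> c_blocks e" using \<open>X \<in> ?\<B>\<close> by blast
    then show ?thesis
    proof cases
      case 1
      then obtain i where X: "X = {i, Suc i}" "b_candidate e i"
        by (auto simp: b_blocks_def dest: b_start_candidate)
      have "realizes_from 1 X ((!) e)"
        unfolding X(1) using X(2) pos[of i] by (intro realizes_from_pair) (auto simp: b_candidate_def)
      moreover have "1 \<le> (\<Sum>i\<in>X. e ! i)"
        using X pos[of i] by (simp add: b_candidate_def)
      ultimately show ?thesis using False by simp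
    next
      case 2
      then obtain i where X: "X = {i}" "i < length e" by (auto simp: c_blocks_def)
      then show ?thesis using False pos[of i] realizes_from_singleton[of i] by simp
    qed
  qed
  have finX: "finite X" if "X \<in> ?\<B>" for X
    using that Union_blocks[of e] by (metis Union_upper finite_lessThan finite_subset)
  have "(\<Sum>X\<in>?\<B>. ?l X) = card (b_blocks e \<union> c_blocks e)"
  proof -
    have "(a_blocks e) \<inter> (b_blocks e \<union> c_blocks e) = {}"
    proof -
      have "X \<noteq> {}" if "X \<in> b_blocks e \<union> c_blocks e" for X
        using that by (auto simp: b_blocks_def c_blocks_def)
      then show ?thesis
        using b_blocks_disjoint_a_blocks[of e] c_blocks_disjoint[of e] by blast
    qed
    then have "?\<B> - a_blocks e = b_blocks e \<union> c_blocks e" by blast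
    moreover have "(\<Sum>X\<in>?\<B>. ?l X) = (\<Sum>X\<in>?\<B> - a_blocks e. 1)"
      using finite_blocks[of e] by (intro sum.mono_neutral_cong_right) auto
    ultimately show ?thesis by simp
  qed
  also have "\<dots> = num_b e + num_c e"
    unfolding num_b_def num_c_def
  proof (rule card_Un_disjoint)
    show "b_blocks e \<inter> c_blocks e = {}" by (auto simp: b_blocks_def c_blocks_def)
  qed (use finite_blocks[of e] in auto)
  finally have l: "(\<Sum>X\<in>?\<B>. ?l X) = num_b e + num_c e" .
  show ?thesis
    using realizes_from_Union[OF finite_blocks pairwise_disjnt_blocks finX X, of e]
    unfolding Union_blocks l by blast
qed

text \<open>One position for each b-block and each c-block; the values there are the critical exponents.\<close>

definition block_starts :: "nat list \<Rightarrow> nat set" where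
  "block_starts e = {i. b_start e i} \<union> {i. {i} \<in> c_blocks e}"

lemma card_block_starts: "card (block_starts e) = num_b e + num_c e"
proof -
  have "b_blocks e = (\<lambda>i. {i, Suc i}) ` {i. b_start e i}" by (auto simp: b_blocks_def)
  moreover have "inj_on (\<lambda>i. {i, Suc i}) {i. b_start e i}"
    by (auto simp: inj_on_def doubleton_eq_iff)
  ultimately have b: "card {i. b_start e i} = num_b e" by (simp add: num_b_def card_image)
  have "c_blocks e = (\<lambda>i. {i}) ` {i. {i} \<in> c_blocks e}" by (auto simp: c_blocks_def)
  moreover have "inj_on (\<lambda>i. {i}) {i. {i} \<in> c_blocks e}" by (auto simp: inj_on_def)
  ultimately have c: "card {i. {i} \<in> c_blocks e} = num_c e" by (metis num_c_def card_image)
  have "{i. b_start e i} \<subseteq> {..<length e}"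
    by (auto simp: b_candidate_def dest!: b_start_candidate)
  moreover have "{i. {i} \<in> c_blocks e} \<subseteq> {..<length e}" by (auto simp: c_blocks_def)
  moreover have "{i. b_start e i} \<inter> {i. {i} \<in> c_blocks e} = {}"
    by (auto simp: c_blocks_def b_blocks_def)
  ultimately show ?thesis
    unfolding block_starts_def b[symmetric] c[symmetric]
    by (intro card_Un_disjoint) (auto intro: finite_subset)
qed

lemma block_starts_less: "i \<in> block_starts e \<Longrightarrow> i < length e"
  by (auto simp: block_starts_def c_blocks_def b_candidate_def dest!: b_start_candidate)

lemma block_starts_not_in_a_blocks: "i \<in> block_starts e \<Longrightarrow> i \<notin> \<Union>(a_blocks e)"
  by (auto simp: block_starts_def c_blocks_def b_candidate_def dest!: b_start_candidate)

text \<open>In a sorted list the positions of a value form an interval, hence a maximal run.\<close>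

lemma in_a_blocks_of_repeated:
  assumes e: "sorted e" and ij: "i < length e" "j < length e" "e ! j = e ! i" "j \<noteq> i"
  shows "i \<in> \<Union>(a_blocks e)"
proof -
  define K where "K = {k. k < length e \<and> e ! k = e ! i}"
  have finK: "finite K" by (simp add: K_def)
  have iK: "i \<in> K" "j \<in> K" using ij by (auto simp: K_def)
  define l m where "l = Min K" and "m = Max K"
  have lm: "l \<in> K" "m \<in> K" unfolding l_def m_def using finK iK by (auto intro: Min_in Max_in)
  have bounds: "l \<le> k" "k \<le> m" if "k \<in> K" for k unfolding l_def m_def using finK that by auto
  have K: "K = {l..<Suc m}"
  proof (rule subset_antisym)
    show "K \<subseteq> {l..<Suc m}" using bounds by (auto simp: less_Suc_eq_le)
    show "{l..<Suc m} \<subseteq> K"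
    proof
      fix k assume k: "k \<in> {l..<Suc m}"
      then have "e ! l \<le> e ! k" "e ! k \<le> e ! m" "k < length e"
        using lm sorted_nth_mono[OF e, of l k] sorted_nth_mono[OF e, of k m] by (auto simp: K_def)
      then show "k \<in> K" using lm by (simp add: K_def)
    qed
  qed
  have "{l..<Suc m} \<in> a_blocks e"
  proof -
    have "l < m" using bounds[OF iK(1)] bounds[OF iK(2)] ij(4) by linarith
    then have "l + 2 \<le> Suc m" by simp
    moreover have "\<forall>k\<in>{l..<Suc m}. e ! k = e ! l"
      using K lm(1) unfolding K_def by fastforce
    moreover have "l = 0 \<or> e ! (l - 1) \<noteq> e ! l"
    proof (rule ccontr)
      assume "\<not> (l = 0 \<or> e ! (l - 1) \<noteq> e ! l)"
      then have "l - 1 \<in> K" "l \<noteq> 0" using lm(1) by (auto simp: K_def)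
      then show False using bounds(1)[of "l - 1"] by linarith
    qed
    moreover have "Suc m = length e \<or> e ! Suc m \<noteq> e ! l"
    proof (rule ccontr)
      assume *: "\<not> (Suc m = length e \<or> e ! Suc m \<noteq> e ! l)"
      then have "Suc m \<in> K" using lm by (auto simp: K_def)
      then show False using bounds(2)[of "Suc m"] by linarith
    qed
    moreover have "Suc m \<le> length e" using lm(2) by (simp add: K_def)
    ultimately show ?thesis unfolding a_blocks_def by blast
  qed
  then show ?thesis using iK K by blast
qed

lemma block_starts_unique:
  assumes "sorted e" "i \<in> block_starts e" "j < length e" "e ! j = e ! i"
  shows "j = i"
  using in_a_blocks_of_repeated[OF assms(1) block_starts_less[OF assms(2)] assms(3,4)]
    block_starts_not_in_a_blocks[OF assms(2)] by blast

text \<open>Otherwise the two positions are adjacent, since critical values occur only once, and they form a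
  candidate for a b-block. The search then opens a b-block at the first position, which makes the
  second one neither a start nor a c-block, or the first position already ends a b-block.\<close>

lemma block_starts_not_consecutive:
  assumes e: "sorted e" and i: "i \<in> block_starts e" and j: "j \<in> block_starts e"
  shows "e ! j \<noteq> Suc (e ! i)"
proof
  assume eq: "e ! j = Suc (e ! i)"
  note len = block_starts_less[OF i] block_starts_less[OF j]
  have "i < j"
    using sorted_nth_mono[OF e, of j i] eq len by (metis Suc_n_not_le_n not_less)
  have "j = Suc i"
  proof (rule ccontr)
    assume "j \<noteq> Suc i"
    then have "Suc i < j" using \<open>i < j\<close> by simp
    then have "e ! i \<le> e ! Suc i" "e ! Suc i \<le> e ! j"
      using len sorted_nth_mono[OF e, of i "Suc i"] sorted_nth_mono[OF e, of "Suc i" j] by auto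
    then have "e ! Suc i = e ! i \<or> e ! Suc i = e ! j" using eq by auto
    then show False
      using block_starts_unique[OF e i, of "Suc i"] block_starts_unique[OF e j, of "Suc i"]
        \<open>Suc i < j\<close> len by auto
  qed
  then have cand: "b_candidate e i"
    using i j eq len block_starts_not_in_a_blocks by (auto simp: b_candidate_def)
  show False
  proof (cases "b_start e i")
    case True
    then show ?thesis
      using j \<open>j = Suc i\<close> by (auto simp: block_starts_def c_blocks_def b_blocks_def)
  next
    case False
    then obtain i' where "i = Suc i'" "b_start e i'" using cand by (cases i) auto
    then show ?thesis using i False by (auto simp: block_starts_def c_blocks_def b_blocks_def)
  qed
qed

section \<open>A section on which every automorphism acts trivially\<close>

definition count_below :: "nat set \<Rightarrow> nat \<Rightarrow> nat" where
  "count_below T v = card {t \<in> T. t < v}"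

definition count_upto :: "nat set \<Rightarrow> nat \<Rightarrow> nat" where
  "count_upto T v = card {t \<in> T. t \<le> v}"

lemma count_upto_eq_count_below:
  assumes "finite T"
  shows "count_upto T v = count_below T v + (if v \<in> T then 1 else 0)"
proof -
  have "{t \<in> T. t \<le> v} = {t \<in> T. t < v} \<union> (if v \<in> T then {v} else {})"
    by (auto simp: order_le_less)
  then show ?thesis using assms by (auto simp: count_upto_def count_below_def)
qed

lemma count_upto_le:
  assumes "0 \<notin> T"
  shows "count_upto T v \<le> v"
proof -
  have "{t \<in> T. t \<le> v} \<subseteq> {1..v}" using assms by (auto simp: Suc_le_eq intro: gr0I)
  then have "card {t \<in> T. t \<le> v} \<le> card {1..v}" by (intro card_mono) auto
  then show ?thesis by (simp add: count_upto_def)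
qed

lemma count_upto_le_count_below:
  assumes "finite T" "w < v"
  shows "count_upto T w \<le> count_below T v"
  unfolding count_upto_def count_below_def using assms by (intro card_mono) auto

text \<open>Since \<open>T\<close> contains no two consecutive numbers, it misses \<open>v\<close> or \<open>v + 1\<close>, so at most \<open>w - v\<close> of the
  \<open>w - v + 1\<close> numbers from \<open>v\<close> to \<open>w\<close> belong to \<open>T\<close>.\<close>

lemma count_upto_le_count_below_plus:
  assumes "\<And>t. t \<in> T \<Longrightarrow> Suc t \<notin> T" "v < w"
  shows "count_upto T w \<le> count_below T v + (w - v)"
proof -
  have "{v, Suc v} \<subseteq> {v..w}" using assms(2) by auto
  then have "T \<inter> {v..w} \<subset> {v..w}" using assms(1)[of v] by blast
  then have "card (T \<inter> {v..w}) < card {v..w}" by (intro psubset_card_mono) auto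
  then have "card (T \<inter> {v..w}) \<le> w - v" using assms by simp
  moreover have "{t \<in> T. t \<le> w} = {t \<in> T. t < v} \<union> (T \<inter> {v..w})" using assms(2) by auto
  then have "count_upto T w \<le> count_below T v + card (T \<inter> {v..w})"
    unfolding count_upto_def count_below_def by (simp add: card_Un_le)
  ultimately show ?thesis by simp
qed

lemma two_group_mult:
  "x \<otimes>\<^bsub>two_group I e\<^esub> y = (\<lambda>i\<in>I. (x i + y i) mod 2 ^ e i)"
  by (simp add: two_group_def)

lemma two_group_one: "\<one>\<^bsub>two_group I e\<^esub> = (\<lambda>i\<in>I. 0)"
  by (simp add: two_group_def)

lemma two_group_inv:
  assumes "finite I" "x \<in> carrier (two_group I e)"
  shows "inv\<^bsub>two_group I e\<^esub> x = (\<lambda>i\<in>I. (- x i) mod 2 ^ e i)"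
proof (rule group.inv_equality)
  show "(\<lambda>i\<in>I. - x i mod 2 ^ e i) \<otimes>\<^bsub>two_group I e\<^esub> x = \<one>\<^bsub>two_group I e\<^esub>"
    by (auto simp: two_group_mult two_group_one mod_simps intro!: restrict_ext)
  show "(\<lambda>i\<in>I. - x i mod 2 ^ e i) \<in> carrier (two_group I e)"
    using assms by (auto simp: carrier_two_group)
qed (use assms in auto)

lemma two_group_pow:
  assumes "finite I" "x \<in> carrier (two_group I e)" "i \<in> I"
  shows "(x [^]\<^bsub>two_group I e\<^esub> (m::nat)) i = (int m * x i) mod 2 ^ e i"
proof (induction m)
  case 0
  then show ?case using assms by (simp add: two_group_one)
next
  case (Suc m)
  then show ?case using assms by (simp add: two_group_mult mod_simps algebra_simps)
qed

text \<open>Divisibility of all coordinates means divisibility in the group, with the quotients themselves as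
  coordinates of a root.\<close>

lemma two_group_root:
  assumes I: "finite I" and x: "x \<in> carrier (two_group I e)"
    and dvd: "\<And>i. i \<in> I \<Longrightarrow> 2 ^ k dvd x i"
  obtains z where "z \<in> carrier (two_group I e)" "x = z [^]\<^bsub>two_group I e\<^esub> (2 ^ k :: nat)"
    "\<And>i. i \<in> I \<Longrightarrow> x i = 2 ^ k * z i"
proof -
  interpret G: comm_group "two_group I e" by simp
  let ?z = "\<lambda>i\<in>I. x i div 2 ^ k"
  have xi: "0 \<le> x i" "x i < 2 ^ e i" if "i \<in> I" for i
    using x I that by (auto simp: carrier_two_group PiE_iff)
  have "x i div 2 ^ k < 2 ^ e i" if "i \<in> I" for i
    using zdiv_mono2[of "x i" 1 "2 ^ k"] xi[OF that] by simp
  then have z: "?z \<in> carrier (two_group I e)"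
    using xi I by (auto simp: carrier_two_group pos_imp_zdiv_nonneg_iff)
  have mul: "x i = 2 ^ k * ?z i" if "i \<in> I" for i using dvd that by simp
  have "x = ?z [^]\<^bsub>two_group I e\<^esub> (2 ^ k :: nat)"
  proof (rule ext)
    fix i
    show "x i = (?z [^]\<^bsub>two_group I e\<^esub> (2 ^ k :: nat)) i"
    proof (cases "i \<in> I")
      case True
      have "(?z [^]\<^bsub>two_group I e\<^esub> (2 ^ k :: nat)) i = (2 ^ k * ?z i) mod 2 ^ e i"
        using two_group_pow[OF I z True, of "2 ^ k"] by (simp only: of_nat_power of_nat_numeral)
      also have "\<dots> = x i mod 2 ^ e i" by (simp only: mul[OF True, symmetric])
      also have "\<dots> = x i" using xi[OF True] by simp
      finally show ?thesis ..
    next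
      case False
      moreover have "?z [^]\<^bsub>two_group I e\<^esub> (2 ^ k :: nat) \<in> carrier (two_group I e)"
        using z by simp
      ultimately show ?thesis using x I by (auto simp: carrier_two_group PiE_iff extensional_def)
    qed
  qed
  then show thesis using that z mul by blast
qed

text \<open>The first of two constraints on endomorphisms: divisible elements have divisible images.\<close>

lemma two_group_hom_pow_dvd:
  assumes I: "finite I" and h: "h \<in> hom (two_group I e) (two_group I e)"
    and z: "z \<in> carrier (two_group I e)" and i: "i \<in> I" and m: "m \<le> k" "m \<le> e i"
  shows "2 ^ m dvd h (z [^]\<^bsub>two_group I e\<^esub> (2 ^ k :: nat)) i"
proof -
  have "h (z [^]\<^bsub>two_group I e\<^esub> (2 ^ k :: nat)) = h z [^]\<^bsub>two_group I e\<^esub> (2 ^ k :: nat)"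
    using h z by (simp add: hom_nat_pow)
  then have "h (z [^]\<^bsub>two_group I e\<^esub> (2 ^ k :: nat)) i = (2 ^ k * h z i) mod 2 ^ e i"
    using two_group_pow[OF I hom_in_carrier[OF h z] i, of "2 ^ k"] by simp
  then show ?thesis
    using m by (simp add: dvd_mod le_imp_power_dvd)
qed

text \<open>The second constraint: an element killed by \<open>2\<^sup>k\<close> has an image killed by \<open>2\<^sup>k\<close>, which in a summand
  of larger exponent forces divisibility.\<close>

lemma two_group_hom_annihilated_dvd:
  assumes I: "finite I" and h: "h \<in> hom (two_group I e) (two_group I e)"
    and x: "x \<in> carrier (two_group I e)" "\<And>j. j \<in> I \<Longrightarrow> 2 ^ e j dvd 2 ^ k * x j"
    and i: "i \<in> I"
  shows "2 ^ (e i - k) dvd h x i"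
proof -
  let ?G = "two_group I e"
  interpret G: comm_group ?G by simp
  have "x [^]\<^bsub>?G\<^esub> (2 ^ k :: nat) = \<one>\<^bsub>?G\<^esub>"
  proof (rule ext)
    fix j
    have "x [^]\<^bsub>?G\<^esub> (2 ^ k :: nat) \<in> carrier ?G" using x by simp
    then show "(x [^]\<^bsub>?G\<^esub> (2 ^ k :: nat)) j = \<one>\<^bsub>?G\<^esub> j"
      using x I two_group_pow[OF I x(1), of j "2 ^ k"]
      by (cases "j \<in> I") (auto simp: two_group_one carrier_two_group PiE_iff extensional_def)
  qed
  then have "h x [^]\<^bsub>?G\<^esub> (2 ^ k :: nat) = \<one>\<^bsub>?G\<^esub>"
    using h x by (metis G.is_group hom_nat_pow hom_one)
  then have "2 ^ e i dvd 2 ^ k * h x i"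
    using two_group_pow[OF I hom_in_carrier[OF h x(1)] i, of "2 ^ k"] i
    by (simp add: two_group_one mod_eq_0_iff_dvd)
  then show ?thesis
  proof (cases "k \<le> e i")
    case True
    then have "2 ^ e i = 2 ^ k * (2 ^ (e i - k) :: int)" by (simp flip: power_add)
    then show ?thesis using \<open>2 ^ e i dvd 2 ^ k * h x i\<close> by simp
  qed simp
qed

definition single :: "nat set \<Rightarrow> nat \<Rightarrow> int \<Rightarrow> nat \<Rightarrow> int" where
  "single I j a = (\<lambda>i\<in>I. if i = j then a else 0)"

lemma single_in_carrier:
  assumes "finite I" "0 \<le> a" "a < 2 ^ e j"
  shows "single I j a \<in> carrier (two_group I e)"
  using assms by (auto simp: single_def carrier_two_group)

text \<open>If the exponent \<open>v\<close> of the j-th summand occurs only once, the corresponding diagonal entry of an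
  automorphism is odd. For otherwise let \<open>u\<close> be the element of order 2 of this summand. Each
  coordinate of \<open>\<phi>(u)\<close> is divisible by \<open>2\<^sup>v\<close>: it vanishes for exponents below \<open>v\<close>, it vanishes at \<open>j\<close> by
  assumption, and the order of \<open>u\<close> yields the divisibility for exponents above \<open>v\<close>. So \<open>\<phi>(u)\<close> is a
  \<open>2\<^sup>v\<close>-th power, hence so is \<open>u\<close>; but such powers vanish at \<open>j\<close>.\<close>

lemma iso_diagonal_parity:
  assumes I: "finite I" and \<phi>: "\<phi> \<in> iso (two_group I e) (two_group I e)"
    and j: "j \<in> I" "\<And>i. \<lbrakk>i \<in> I; e i = e j\<rbrakk> \<Longrightarrow> i = j" "1 \<le> e j"
    and x: "single I j a \<in> carrier (two_group I e)"
  shows "2 dvd a - \<phi> (single I j a) j"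
proof -
  let ?G = "two_group I e" and ?x = "single I j a" and ?v = "e j"
  interpret G: comm_group ?G by simp
  have hom: "\<phi> \<in> hom ?G ?G" using \<phi> by (simp add: iso_def)
  have xj: "?x j = a" "\<And>i. i \<in> I \<Longrightarrow> i \<noteq> j \<Longrightarrow> ?x i = 0" using j by (auto simp: single_def)
  show ?thesis
  proof (cases "even a")
    case True
    have "2 ^ 1 dvd ?x i" if "i \<in> I" for i using True that by (auto simp: single_def)
    then obtain z where z: "z \<in> carrier ?G" "?x = z [^]\<^bsub>?G\<^esub> (2 ^ 1 :: nat)"
      using two_group_root[OF I x, of 1] by blast
    have "2 ^ 1 dvd \<phi> ?x j"
      unfolding z(2) by (rule two_group_hom_pow_dvd[OF I hom z(1) j(1)]) (use j(3) in auto)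
    then show ?thesis using True by simp
  next
    case odd: False
    have "odd (\<phi> ?x j)"
    proof
      assume ev: "even (\<phi> ?x j)"
      \<comment> \<open>The element of order 2 in the j-th summand is \<open>?u\<close>.\<close>
      obtain c where v: "?v = Suc c" using j(3) by (cases ?v) auto
      let ?u = "?x [^]\<^bsub>?G\<^esub> (2 ^ c :: nat)"
      have u: "?u \<in> carrier ?G" using x by simp
      have \<phi>u: "\<phi> ?u = \<phi> ?x [^]\<^bsub>?G\<^esub> (2 ^ c :: nat)" using hom x by (simp add: hom_nat_pow)
      have "2 ^ ?v dvd \<phi> ?u i" if i: "i \<in> I" for i
      proof -
        have pw: "\<phi> ?u i = (2 ^ c * \<phi> ?x i) mod 2 ^ e i"
          unfolding \<phi>u using two_group_pow[OF I hom_in_carrier[OF hom x] i, of "2 ^ c"] by simp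
        consider "e i \<le> c" | "i = j" | "?v < e i"
          using j(2)[OF i] v by linarith
        then show ?thesis
        proof cases
          case 1
          then have "2 ^ e i dvd 2 ^ c * \<phi> ?x i" by (simp add: le_imp_power_dvd)
          then show ?thesis using pw by (simp add: mod_eq_0_iff_dvd)
        next
          case 2
          then have "2 ^ e i dvd 2 ^ c * \<phi> ?x i" using ev v by (simp add: mult.commute)
          then show ?thesis using pw by (simp add: mod_eq_0_iff_dvd)
        next
          case 3
          have "2 ^ (e i - ?v) dvd \<phi> ?x i"
          proof (rule two_group_hom_annihilated_dvd[OF I hom x _ i])
            show "2 ^ e k dvd 2 ^ ?v * ?x k" if "k \<in> I" for k
              using that by (auto simp: single_def)
          qed
          moreover have "(2::int) dvd 2 ^ (e i - ?v)" using 3 by simp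
          ultimately have "2 dvd \<phi> ?x i" by (rule dvd_trans[rotated])
          then have "2 ^ ?v dvd 2 ^ c * \<phi> ?x i" using v by (simp add: mult.commute)
          moreover have "(2::int) ^ ?v dvd 2 ^ e i" using 3 by (simp add: le_imp_power_dvd)
          ultimately show ?thesis unfolding pw by (simp add: dvd_mod)
        qed
      qed
      then obtain w where w: "w \<in> carrier ?G" "\<phi> ?u = w [^]\<^bsub>?G\<^esub> (2 ^ ?v :: nat)"
        using two_group_root[OF I hom_in_carrier[OF hom u], of ?v] by blast
      obtain w' where w': "w' \<in> carrier ?G" "w = \<phi> w'"
        using \<phi> w(1) by (auto simp: iso_def bij_betw_def)
      then have "\<phi> ?u = \<phi> (w' [^]\<^bsub>?G\<^esub> (2 ^ ?v :: nat))"
        using w hom by (simp add: hom_nat_pow)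
      then have "?u = w' [^]\<^bsub>?G\<^esub> (2 ^ ?v :: nat)"
        using \<phi> u w' by (auto simp: iso_def bij_betw_def inj_on_def)
      then have "?u j = 0" using two_group_pow[OF I w'(1) j(1), of "2 ^ ?v"] by simp
      moreover have "?u j = (2 ^ c * a) mod 2 ^ ?v"
        using two_group_pow[OF I x j(1), of "2 ^ c"] xj by simp
      ultimately have "2 ^ ?v dvd 2 ^ c * a" by (simp add: mod_eq_0_iff_dvd)
      then show False using odd v by simp
    qed
    then show ?thesis using odd by simp
  qed
qed

text \<open>For \<open>f\<close> such that \<open>f(v)\<close> and \<open>v - f(v)\<close> are both nondecreasing in \<open>v\<close>, these are characteristic
  subgroups; the two functions used below are of this kind.\<close>

definition filtration :: "nat set \<Rightarrow> (nat \<Rightarrow> nat) \<Rightarrow> (nat \<Rightarrow> nat) \<Rightarrow> (nat \<Rightarrow> int) set" where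
  "filtration I e f = {x \<in> carrier (two_group I e). \<forall>i\<in>I. 2 ^ f (e i) dvd x i}"

lemma subgroup_filtration:
  assumes I: "finite I" and f: "\<And>v. f v \<le> v"
  shows "subgroup (filtration I e f) (two_group I e)"
proof -
  interpret G: comm_group "two_group I e" by simp
  have d: "(2::int) ^ f (e i) dvd 2 ^ e i" for i using f by (simp add: le_imp_power_dvd)
  show ?thesis
  proof (rule G.subgroupI)
    have "\<one>\<^bsub>two_group I e\<^esub> \<in> filtration I e f"
      by (simp add: filtration_def) (simp add: two_group_one)
    then show "filtration I e f \<noteq> {}" by blast
  next
    fix x assume x: "x \<in> filtration I e f"
    then have "x \<in> carrier (two_group I e)" by (simp add: filtration_def)
    moreover from this have "(inv\<^bsub>two_group I e\<^esub> x) i = (- x i) mod 2 ^ e i" if "i \<in> I" for i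
      using that I by (simp add: two_group_inv)
    ultimately show "inv\<^bsub>two_group I e\<^esub> x \<in> filtration I e f"
      using x d by (simp add: filtration_def dvd_mod)
  next
    fix x y assume "x \<in> filtration I e f" "y \<in> filtration I e f"
    moreover have "(x \<otimes>\<^bsub>two_group I e\<^esub> y) i = (x i + y i) mod 2 ^ e i" if "i \<in> I" for i
      using that by (simp add: two_group_mult)
    ultimately show "x \<otimes>\<^bsub>two_group I e\<^esub> y \<in> filtration I e f"
      using d by (simp add: filtration_def dvd_mod)
  qed (auto simp: filtration_def)
qed

lemma card_filtration:
  assumes I: "finite I" and f: "\<And>v. f v \<le> v"
  shows "card (filtration I e f) = (\<Prod>i\<in>I. 2 ^ (e i - f (e i)))"
proof -
  have "filtration I e f = (\<Pi>\<^sub>E i\<in>I. {a \<in> {0..<2 ^ e i}. 2 ^ f (e i) dvd a})"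
    using I by (auto simp: filtration_def carrier_two_group PiE_iff extensional_def)
  moreover have "card {a \<in> {0..<2 ^ e i :: int}. 2 ^ f (e i) dvd a} = 2 ^ (e i - f (e i))" for i
  proof -
    have "2 ^ f (e i) * 2 ^ (e i - f (e i)) = (2 ^ e i :: nat)"
      using f by (simp flip: power_add)
    then show ?thesis using card_multiples[of "2 ^ f (e i)" "2 ^ (e i - f (e i))"] by simp
  qed
  ultimately show ?thesis using I by (simp add: card_PiE)
qed

text \<open>Here \<open>\<theta>\<close> maps the subgroup \<open>?B\<close> of the filtration given by \<open>count_below T\<close> into the subgroup \<open>?C\<close>
  given by \<open>count_upto T\<close>. It suffices to see this for elements supported at a single position \<open>j\<close>. At
  a position with another exponent, the image is divisible enough by the two constraints on
  endomorphisms and the inequalities between the counting functions. At \<open>j\<close> itself one more factor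
  2 is needed when the exponent lies in \<open>T\<close>; it comes from the parity of the diagonal entry.\<close>

theorem card_fixed_points_two_group_ge:
  assumes I: "finite I" and \<phi>: "\<phi> \<in> iso (two_group I e) (two_group I e)"
    and T: "T \<subseteq> e ` I" "0 \<notin> T" "\<And>t. t \<in> T \<Longrightarrow> Suc t \<notin> T"
    and unique: "\<And>i j. \<lbrakk>i \<in> I; j \<in> I; e i \<in> T; e j = e i\<rbrakk> \<Longrightarrow> j = i"
  shows "2 ^ card T \<le> card (fixed_points (two_group I e) \<phi>)"
proof -
  let ?G = "two_group I e"
  interpret G: comm_group ?G by simp
  have finT: "finite T" using T(1) I finite_surj by blast
  have count_below_le: "count_below T v \<le> v" for v
    using count_upto_eq_count_below[OF finT, of v] count_upto_le[OF T(2), of v] by simp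
  have count_upto_le_plus: "count_upto T w \<le> count_below T v + (w - v)" if "v < w" for v w
    by (rule count_upto_le_count_below_plus) (use T(3) that in auto)
  note below_facts = count_upto_eq_count_below[OF finT] count_upto_le[OF T(2)] count_below_le
    count_upto_le_count_below[OF finT] count_upto_le_plus
  let ?f = "count_below T" and ?g = "count_upto T"
  let ?B = "filtration I e ?f" and ?C = "filtration I e ?g" and ?\<theta> = "displacement ?G \<phi>"
  have hom: "\<phi> \<in> hom ?G ?G" using \<phi> by (simp add: iso_def)
  have \<theta>: "?\<theta> \<in> hom ?G ?G" by (rule displacement_hom) (use hom in auto)
  have subB: "subgroup ?B ?G" and subC: "subgroup ?C ?G"
    using below_facts by (auto intro!: subgroup_filtration I)
  have \<theta>_single: "?\<theta> (single I j a) \<in> ?C"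
    if j: "j \<in> I" and a: "0 \<le> a" "a < 2 ^ e j" "2 ^ ?f (e j) dvd a" for j a
  proof -
    let ?x = "single I j a" and ?F = "?f (e j)"
    have x: "?x \<in> carrier ?G" by (rule single_in_carrier) (use I a in auto)
    have "2 ^ ?g (e i) dvd ?x i - \<phi> ?x i" if i: "i \<in> I" for i
    proof -
      have F: "?F \<le> e j" using below_facts(3) .
      have "2 ^ ?F dvd ?x i" if "i \<in> I" for i using a that by (auto simp: single_def)
      then obtain z where z: "z \<in> carrier ?G" "?x = z [^]\<^bsub>?G\<^esub> (2 ^ ?F :: nat)"
        "\<And>i. i \<in> I \<Longrightarrow> ?x i = 2 ^ ?F * z i"
        using two_group_root[OF I x, of ?F] by blast
      have low: "2 ^ m dvd \<phi> ?x i" if "m \<le> ?F" "m \<le> e i" for m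
        using two_group_hom_pow_dvd[OF I hom z(1) i that] z(2) by simp
      have gi: "?g (e i) \<le> e i" using below_facts(2) .
      \<comment> \<open>A critical exponent occurs only once, so equal exponents in \<open>T\<close> force \<open>i = j\<close>.\<close>
      consider "e i < e j" | "e j < e i" | "e i = e j" "e j \<notin> T" | "i = j" "e j \<in> T"
        using unique[OF j i] by linarith
      then show ?thesis
      proof cases
        case 1
        then have "?x i = 0" using i by (auto simp: single_def)
        then show ?thesis using low[OF below_facts(4)[OF 1] gi] by simp
      next
        case 2
        then have "?x i = 0" using i by (auto simp: single_def)
        have "2 ^ (e i - (e j - ?F)) dvd \<phi> ?x i"
        proof (rule two_group_hom_annihilated_dvd[OF I hom x _ i])
          fix k assume "k \<in> I"
          have "(2::int) ^ e j = 2 ^ (e j - ?F) * 2 ^ ?F" using F by (simp flip: power_add)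
          then have "2 ^ e j dvd 2 ^ (e j - ?F) * a" using a(3) by simp
          then show "2 ^ e k dvd 2 ^ (e j - ?F) * ?x k"
            using \<open>k \<in> I\<close> by (auto simp: single_def)
        qed
        moreover have "?g (e i) \<le> e i - (e j - ?F)"
          using below_facts(5)[OF 2] 2 F by linarith
        ultimately have "2 ^ ?g (e i) dvd \<phi> ?x i"
          by (meson dvd_trans le_imp_power_dvd)
        then show ?thesis using \<open>?x i = 0\<close> by simp
      next
        case 3
        then have "?g (e i) = ?F" using below_facts(1)[of "e j"] by simp
        moreover have "2 ^ ?F dvd ?x i" using a i by (auto simp: single_def)
        ultimately show ?thesis using low[of ?F] gi by simp
      next
        case 4
        have gF: "?g (e j) = Suc ?F" using 4 below_facts(1)[of "e j"] by simp
        have z_single: "z = single I j (z j)"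
        proof (rule ext)
          fix k show "z k = single I j (z j) k"
            using z(1) z(3)[of k] I by (auto simp: single_def carrier_two_group PiE_iff extensional_def)
        qed
        have "2 dvd z j - \<phi> (single I j (z j)) j"
        proof (rule iso_diagonal_parity[OF I \<phi> j])
          show "1 \<le> e j" using 4 T(2) by (cases "e j") auto
        qed (use unique[OF j] 4 z(1) z_single in auto)
        then have "2 dvd z j - \<phi> z j" using z_single by simp
        then have "2 ^ Suc ?F dvd 2 ^ ?F * (z j - \<phi> z j)" by (simp add: mult.commute)
        moreover have "2 ^ Suc ?F dvd 2 ^ ?F * \<phi> z j - \<phi> ?x j"
        proof -
          have "\<phi> ?x j = (2 ^ ?F * \<phi> z j) mod 2 ^ e j"
            using two_group_pow[OF I hom_in_carrier[OF hom z(1)] j, of "2 ^ ?F"] z(1) hom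
            by (simp add: z(2) hom_nat_pow)
          then have "2 ^ e j dvd 2 ^ ?F * \<phi> z j - \<phi> ?x j" by (simp add: dvd_minus_mod)
          moreover have "(2::int) ^ Suc ?F dvd 2 ^ e j"
            using gi 4 gF by (metis le_imp_power_dvd)
          ultimately show ?thesis by (rule dvd_trans[rotated])
        qed
        ultimately have "2 ^ Suc ?F dvd 2 ^ ?F * (z j - \<phi> z j) + (2 ^ ?F * \<phi> z j - \<phi> ?x j)"
          by (rule dvd_add)
        also have "\<dots> = ?x j - \<phi> ?x j" using z(3)[OF j] by (simp add: algebra_simps)
        finally show ?thesis using 4 gF by simp
      qed
    qed
    moreover have "?\<theta> ?x i = (?x i - \<phi> ?x i) mod 2 ^ e i" if "i \<in> I" for i
      using that I hom_in_carrier[OF hom x]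
      by (simp add: displacement_def two_group_mult two_group_inv mod_simps)
    ultimately have "\<forall>i\<in>I. 2 ^ ?g (e i) dvd ?\<theta> ?x i"
      using below_facts(2) by (simp add: dvd_mod le_imp_power_dvd)
    then show ?thesis using hom_in_carrier[OF \<theta> x] by (simp add: filtration_def)
  qed
  have \<theta>_supp: "?\<theta> x \<in> ?C" if "J \<subseteq> I" "x \<in> ?B" "\<And>i. i \<in> I - J \<Longrightarrow> x i = 0" for J x
    using finite_subset[OF that(1) I] that
  proof (induction J arbitrary: x rule: finite_induct)
    case empty
    then have "x = \<one>\<^bsub>?G\<^esub>"
      using I by (auto simp: two_group_one filtration_def carrier_two_group PiE_iff extensional_def fun_eq_iff)
    then show ?case using hom_one[OF \<theta>] subgroup.one_closed[OF subC] by simp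
  next
    case (insert j J)
    let ?y = "\<lambda>i\<in>I. if i = j then 0 else x i"
    have xi: "x i \<in> {0..<2 ^ e i}" "2 ^ ?f (e i) dvd x i" if "i \<in> I" for i
      using insert.prems(2) that I by (auto simp: filtration_def carrier_two_group PiE_iff)
    have x: "x \<in> extensional I" using insert.prems(2) I by (auto simp: filtration_def carrier_two_group PiE_iff)
    have y: "?y \<in> ?B" using xi I by (auto simp: filtration_def carrier_two_group)
    have "?\<theta> ?y \<in> ?C" by (rule insert.IH[OF _ y]) (use insert.prems in auto)
    moreover have s: "?\<theta> (single I j (x j)) \<in> ?C"
      by (rule \<theta>_single) (use insert.prems xi[of j] in auto)
    moreover have split: "x = ?y \<otimes>\<^bsub>?G\<^esub> single I j (x j)"
      using x xi by (auto simp: two_group_mult single_def fun_eq_iff extensional_def)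
    moreover have "single I j (x j) \<in> carrier ?G"
      by (rule single_in_carrier) (use I xi[of j] insert.prems in auto)
    moreover have "?y \<in> carrier ?G" using y by (simp add: filtration_def)
    ultimately have "?\<theta> x = ?\<theta> ?y \<otimes>\<^bsub>?G\<^esub> ?\<theta> (single I j (x j))"
      using hom_mult[OF \<theta>, of ?y "single I j (x j)"] by simp
    then show ?case using subgroup.m_closed[OF subC \<open>?\<theta> ?y \<in> ?C\<close> s] by simp
  qed
  have "?\<theta> ` ?B \<subseteq> ?C" using \<theta>_supp[of I] by auto
  have finC: "finite ?C" "finite (fixed_points ?G \<phi>)"
    using I by (simp_all add: filtration_def fixed_points_def)
  \<comment> \<open>Compare \<open>|B|\<close> with the product of the orders of kernel and image of \<open>\<theta>\<close> on \<open>B\<close>.\<close>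
  let ?GB = "?G\<lparr>carrier := ?B\<rparr>"
  have "?\<theta> \<in> hom ?GB ?G"
    using \<theta> subgroup.subset[OF subB] by (auto simp: hom_def)
  then have "card (kernel ?GB ?G ?\<theta>) * card (?\<theta> ` ?B) = card ?B"
    using card_kernel_mult_card_image[of ?GB ?G ?\<theta>] subgroup.subgroup_is_group[OF subB]
    by (simp add: order_def)
  moreover have "kernel ?GB ?G ?\<theta> \<subseteq> kernel ?G ?G ?\<theta>"
    using subgroup.subset[OF subB] by (auto simp: kernel_def)
  then have "card (kernel ?GB ?G ?\<theta>) \<le> card (fixed_points ?G \<phi>)"
    using kernel_displacement[of ?G \<phi>] hom finC by (simp add: card_mono)
  moreover have "card (?\<theta> ` ?B) \<le> card ?C" using \<open>?\<theta> ` ?B \<subseteq> ?C\<close> finC by (simp add: card_mono)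
  ultimately have "card ?B \<le> card (fixed_points ?G \<phi>) * card ?C"
    by (metis mult_le_mono)
  moreover have "card ?B = 2 ^ card T * card ?C"
  proof -
    have "card ?B = (\<Prod>i\<in>I. 2 ^ (e i - ?g (e i)) * 2 ^ (if e i \<in> T then 1 else 0))"
      unfolding card_filtration[OF I below_facts(3)]
    proof (rule prod.cong)
      fix i
      have "e i - ?f (e i) = (e i - ?g (e i)) + (if e i \<in> T then 1 else 0)"
        using below_facts(1,2)[of "e i"] by auto
      then show "2 ^ (e i - ?f (e i)) = (2::nat) ^ (e i - ?g (e i)) * 2 ^ (if e i \<in> T then 1 else 0)"
        by (simp add: power_add)
    qed simp
    also have "\<dots> = card ?C * (\<Prod>i\<in>I. 2 ^ (if e i \<in> T then 1 else 0))"
      unfolding card_filtration[OF I below_facts(2)] by (rule prod.distrib)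
    also have "(\<Prod>i\<in>I. (2::nat) ^ (if e i \<in> T then 1 else 0)) = 2 ^ card {i \<in> I. e i \<in> T}"
      using I by (simp add: power_sum[symmetric] sum.If_cases Int_def)
    also have "card {i \<in> I. e i \<in> T} = card T"
    proof (rule bij_betw_same_card[of e])
      show "bij_betw e {i \<in> I. e i \<in> T} T"
        using T(1) unique by (auto simp: bij_betw_def inj_on_def)
    qed
    finally show ?thesis by (simp add: mult.commute)
  qed
  moreover have "card ?C > 0"
    using subgroup.one_closed[OF subC] finC by (auto simp: card_gt_0_iff)
  ultimately show ?thesis by simp
qed

corollary card_fixed_points_of_type_ge:
  assumes "sorted e" "\<forall>x\<in>set e. 1 \<le> x"
    and \<phi>: "\<phi> \<in> iso (two_group {..<length e} ((!) e)) (two_group {..<length e} ((!) e))"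
  shows "2 ^ (num_b e + num_c e) \<le> card (fixed_points (two_group {..<length e} ((!) e)) \<phi>)"
proof -
  let ?T = "(!) e ` block_starts e"
  have "inj_on ((!) e) (block_starts e)"
    using block_starts_unique[OF assms(1)] block_starts_less by (meson inj_onI)
  then have "card ?T = num_b e + num_c e" by (simp add: card_image card_block_starts)
  moreover have "2 ^ card ?T \<le> card (fixed_points (two_group {..<length e} ((!) e)) \<phi>)"
  proof (rule card_fixed_points_two_group_ge[OF _ \<phi>])
    show "?T \<subseteq> (!) e ` {..<length e}" using block_starts_less by auto
    show "0 \<notin> ?T" using assms(2) block_starts_less by (metis imageE not_one_le_zero nth_mem)
    show "Suc t \<notin> ?T" if "t \<in> ?T" for t
      using that block_starts_not_consecutive[OF assms(1)] by (metis imageE)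
    show "j = i" if "i \<in> {..<length e}" "j \<in> {..<length e}" "e ! i \<in> ?T" "e ! j = e ! i" for i j
      using that block_starts_unique[OF assms(1)] by (metis imageE lessThan_iff)
  qed simp
  ultimately show ?thesis by simp
qed

section \<open>Groups of odd order\<close>

lemma internal_product_iso:
  assumes "comm_group G" "subgroup H G" "subgroup K G"
    and "H \<inter> K \<subseteq> {\<one>\<^bsub>G\<^esub>}" "H <#>\<^bsub>G\<^esub> K = carrier G"
  shows "G\<lparr>carrier := H\<rparr> \<times>\<times> G\<lparr>carrier := K\<rparr> \<cong> G"
proof -
  interpret comm_group G by fact
  interpret group_disjoint_sum G H K
    using assms by (simp add: group_disjoint_sum_def)
  have "subgroup_generated G H = G\<lparr>carrier := H\<rparr>" "subgroup_generated G K = G\<lparr>carrier := K\<rparr>"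
    using AG.carrier_subgroup_generated_subgroup BG.carrier_subgroup_generated_subgroup
    by (simp_all add: subgroup_generated_def)
  then show ?thesis
    using iso_group_mul[OF assms(1)] assms(4,5) by (auto intro: is_isoI)
qed

lemma comm_group_subgroup:
  assumes "comm_group G" "subgroup H G"
  shows "comm_group (G\<lparr>carrier := H\<rparr>)"
proof -
  interpret comm_group G by fact
  show ?thesis
    using assms(2) subgroup.mem_carrier[OF assms(2)]
    by (intro group.group_comm_groupI subgroup.subgroup_is_group) (auto simp: m_comm)
qed

lemma spectrum_internal_product:
  assumes "comm_group G" "finite (carrier G)" "subgroup H G" "subgroup K G"
    and "H \<inter> K \<subseteq> {\<one>\<^bsub>G\<^esub>}" "H <#>\<^bsub>G\<^esub> K = carrier G"
    and "c \<in> Reidemeister_spectrum (G\<lparr>carrier := H\<rparr>)" "d \<in> Reidemeister_spectrum (G\<lparr>carrier := K\<rparr>)"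
  shows "c * d \<in> Reidemeister_spectrum G"
proof -
  have fin: "finite H" "finite K"
    using assms(2-4) by (meson finite_subset subgroup.subset)+
  have "Reidemeister_spectrum (G\<lparr>carrier := H\<rparr> \<times>\<times> G\<lparr>carrier := K\<rparr>) = Reidemeister_spectrum G"
    using internal_product_iso[OF assms(1,3-6)] assms(1-4) fin
    by (intro spectrum_iso DirProd_comm_group comm_group_subgroup) auto
  moreover have "c * d \<in> Reidemeister_spectrum (G\<lparr>carrier := H\<rparr> \<times>\<times> G\<lparr>carrier := K\<rparr>)"
    using assms fin by (intro spectrum_DirProd comm_group_subgroup) auto
  ultimately show ?thesis by simp
qed

lemma card_internal_product:
  assumes "comm_group G" "subgroup H G" "subgroup K G"
    and "H \<inter> K \<subseteq> {\<one>\<^bsub>G\<^esub>}" "H <#>\<^bsub>G\<^esub> K = carrier G"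
  shows "order G = card H * card K"
  using iso_same_card[OF internal_product_iso[OF assms]]
  by (simp add: order_def card_cartesian_product)

lemma subgroup_nat_pow_closed:
  assumes "subgroup U G" "y \<in> U"
  shows "y [^]\<^bsub>G\<^esub> (i::nat) \<in> U"
proof (induction i)
  case 0
  then show ?case using subgroup.one_closed[OF assms(1)] by simp
next
  case (Suc i)
  then show ?case using subgroup.m_closed[OF assms(1)] assms(2) by simp
qed

lemma coprime_bezout_nat:
  fixes a m :: nat
  assumes "coprime a m" "m \<noteq> 0"
  obtains u w where "m * u = a * w + 1"
  using bezout_nat[of m a] assms by (auto simp: gcd.commute)

context
  fixes G :: "('a, 'b) monoid_scheme" and S :: "'a set" and m :: nat
  assumes cg: "comm_group G" and fin: "finite (carrier G)" and S: "subgroup S G"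
    and ord: "order G = card S * m" and cop: "coprime (card S) m"
begin

interpretation comm_group G by (rule cg)

text \<open>The quotient by \<open>S\<close> has order \<open>m\<close>.\<close>

lemma pow_cofactor_in_subgroup:
  assumes x: "x \<in> carrier G"
  shows "x [^]\<^bsub>G\<^esub> m \<in> S"
proof -
  interpret S: normal S G by (rule subgroup_imp_normal[OF S])
  have "card (rcosets\<^bsub>G\<^esub> S) * card S = m * card S"
    using lagrange[OF S] ord by (simp add: mult.commute)
  moreover have "card S \<noteq> 0"
    using fin S by (metis finite_subset subgroup.subset subgroup.one_closed card_0_eq empty_iff)
  ultimately have o: "order (G Mod S) = m" by (simp add: order_def FactGroup_def)
  interpret Q: group "G Mod S" by (rule S.factorgroup_is_group)
  have c: "S #>\<^bsub>G\<^esub> x \<in> carrier (G Mod S)" using x by (simp add: carrier_FactGroup)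
  have "(S #>\<^bsub>G\<^esub> x) [^]\<^bsub>G Mod S\<^esub> m = S" using Q.pow_order_eq_1[OF c] o by simp
  then have "S #>\<^bsub>G\<^esub> (x [^]\<^bsub>G\<^esub> m) = S" using S.FactGroup_pow[OF x] by simp
  then show ?thesis using rcos_self[OF nat_pow_closed[OF x, of m] S] by simp
qed

lemma pow_card_subgroup: "x \<in> S \<Longrightarrow> x [^]\<^bsub>G\<^esub> card S = \<one>\<^bsub>G\<^esub>"
proof -
  assume x: "x \<in> S"
  interpret SG: group "G\<lparr>carrier := S\<rparr>" by (rule subgroup.subgroup_is_group[OF S is_group])
  show ?thesis
    using SG.pow_order_eq_1[of x] x nat_pow_consistent[of x "card S" S] by (simp add: order_def)
qed

text \<open>The exponent \<open>m u\<close> acts as the identity on elements of order dividing \<open>|S|\<close> and kills those of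
  order dividing \<open>m\<close>, so raising to this power is the projection onto \<open>S\<close>.\<close>

lemma bezout_pow:
  obtains u where "\<And>y. \<lbrakk>y \<in> carrier G; y [^]\<^bsub>G\<^esub> card S = \<one>\<^bsub>G\<^esub>\<rbrakk> \<Longrightarrow> y [^]\<^bsub>G\<^esub> (m * u) = y"
proof -
  have "m \<noteq> 0" using ord fin order_gt_0_iff_finite by fastforce
  then obtain u w where uw: "m * u = card S * w + 1" using coprime_bezout_nat[OF cop] by blast
  have "y [^]\<^bsub>G\<^esub> (m * u) = y" if "y \<in> carrier G" "y [^]\<^bsub>G\<^esub> card S = \<one>\<^bsub>G\<^esub>" for y
  proof -
    have "y [^]\<^bsub>G\<^esub> (m * u) = (y [^]\<^bsub>G\<^esub> card S) [^]\<^bsub>G\<^esub> w \<otimes>\<^bsub>G\<^esub> y"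
      unfolding uw using that(1) by (simp add: nat_pow_pow)
    then show ?thesis using that by simp
  qed
  then show thesis using that by blast
qed

text \<open>In particular \<open>S\<close> is mapped into itself by every endomorphism.\<close>

lemma hall_subgroup_iff:
  assumes x: "x \<in> carrier G"
  shows "x \<in> S \<longleftrightarrow> x [^]\<^bsub>G\<^esub> card S = \<one>\<^bsub>G\<^esub>"
proof
  assume "x [^]\<^bsub>G\<^esub> card S = \<one>\<^bsub>G\<^esub>"
  then obtain u where "x [^]\<^bsub>G\<^esub> (m * u) = x" using bezout_pow x by metis
  moreover have "(x [^]\<^bsub>G\<^esub> m) [^]\<^bsub>G\<^esub> u \<in> S"
    by (rule subgroup_nat_pow_closed[OF S pow_cofactor_in_subgroup[OF x]])
  ultimately show "x \<in> S" using x by (simp add: nat_pow_pow)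
qed (rule pow_card_subgroup)

lemma hall_complement:
  defines "K \<equiv> {x \<in> carrier G. x [^]\<^bsub>G\<^esub> m = \<one>\<^bsub>G\<^esub>}"
  shows "subgroup K G" "S \<inter> K \<subseteq> {\<one>\<^bsub>G\<^esub>}" "S <#>\<^bsub>G\<^esub> K = carrier G" "card K = m"
proof -
  obtain u where u: "\<And>y. \<lbrakk>y \<in> carrier G; y [^]\<^bsub>G\<^esub> card S = \<one>\<^bsub>G\<^esub>\<rbrakk> \<Longrightarrow> y [^]\<^bsub>G\<^esub> (m * u) = y"
    using bezout_pow by blast
  have Sc: "S \<subseteq> carrier G" using S by (rule subgroup.subset)
  show K: "subgroup K G"
  proof (rule subgroupI)
    have "\<one>\<^bsub>G\<^esub> \<in> K" by (simp add: K_def)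
    then show "K \<noteq> {}" by blast
  qed (auto simp: K_def nat_pow_inv nat_pow_distrib)
  show disj: "S \<inter> K \<subseteq> {\<one>\<^bsub>G\<^esub>}"
  proof
    fix x assume x: "x \<in> S \<inter> K"
    then have "x = (x [^]\<^bsub>G\<^esub> m) [^]\<^bsub>G\<^esub> u"
      using u[of x] pow_card_subgroup[of x] Sc by (auto simp: nat_pow_pow)
    then show "x \<in> {\<one>\<^bsub>G\<^esub>}" using x by (simp add: K_def)
  qed
  show prod: "S <#>\<^bsub>G\<^esub> K = carrier G"
  proof (rule subset_antisym)
    show "S <#>\<^bsub>G\<^esub> K \<subseteq> carrier G" using Sc by (intro setmult_subset_G) (auto simp: K_def)
    show "carrier G \<subseteq> S <#>\<^bsub>G\<^esub> K"
    proof
      fix x assume x: "x \<in> carrier G"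
      let ?y = "x [^]\<^bsub>G\<^esub> m"
      \<comment> \<open>The component of \<open>x\<close> in \<open>S\<close> is its image under the projection \<open>x \<mapsto> x\<^sup>m\<^sup>u\<close>.\<close>
      let ?s = "?y [^]\<^bsub>G\<^esub> u"
      have y: "?y \<in> S" "?y \<in> carrier G" using pow_cofactor_in_subgroup x by auto
      have "?s [^]\<^bsub>G\<^esub> card S = (?y [^]\<^bsub>G\<^esub> card S) [^]\<^bsub>G\<^esub> u"
        using x by (simp add: nat_pow_pow mult.commute mult.left_commute)
      then have "?s [^]\<^bsub>G\<^esub> card S = \<one>\<^bsub>G\<^esub>" using pow_card_subgroup[OF y(1)] by simp
      then have s: "?s \<in> S" using hall_subgroup_iff x by simp
      have "?s [^]\<^bsub>G\<^esub> m = ?y [^]\<^bsub>G\<^esub> (m * u)"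
        using x by (simp add: nat_pow_pow mult.commute mult.left_commute)
      also have "\<dots> = ?y" by (rule u[OF y(2) pow_card_subgroup[OF y(1)]])
      finally have "(x \<otimes>\<^bsub>G\<^esub> inv\<^bsub>G\<^esub> ?s) [^]\<^bsub>G\<^esub> m = \<one>\<^bsub>G\<^esub>"
        using x by (simp add: nat_pow_distrib nat_pow_inv)
      then have "x \<otimes>\<^bsub>G\<^esub> inv\<^bsub>G\<^esub> ?s \<in> K" using x by (simp add: K_def)
      moreover have "x = ?s \<otimes>\<^bsub>G\<^esub> (x \<otimes>\<^bsub>G\<^esub> inv\<^bsub>G\<^esub> ?s)"
        using x by (simp add: m_lcomm)
      ultimately show "x \<in> S <#>\<^bsub>G\<^esub> K" using s unfolding set_mult_def by blast
    qed
  qed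
  have "card S * card K = card S * m"
    using card_internal_product[OF cg S K disj prod] ord by (rule trans[OF sym])
  moreover have "card S \<noteq> 0" using ord fin order_gt_0_iff_finite by fastforce
  ultimately show "card K = m" by simp
qed

end

lemma cyclic_subgroup_iso:
  assumes "group G" "finite (carrier G)" "g \<in> carrier G"
  shows "integer_mod_group (group.ord G g) \<cong> G\<lparr>carrier := generate G {g}\<rparr>"
proof -
  interpret group G by fact
  let ?N = "ord g"
  let ?f = "\<lambda>x::int. g [^]\<^bsub>G\<^esub> x"
  have N: "0 < ?N" using ord_ge_1[OF assms(2,3)] by simp
  have eq: "g [^]\<^bsub>G\<^esub> x = g [^]\<^bsub>G\<^esub> y \<longleftrightarrow> int ?N dvd y - x" for x y :: int
    using int_pow_eq[OF assms(3)] by simp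
  have carr: "carrier (integer_mod_group ?N) = {0..<int ?N}"
    using N by (simp add: carrier_integer_mod_group)
  have inj: "inj_on ?f {0..<int ?N}"
  proof (rule inj_onI)
    fix x y assume xy: "x \<in> {0..<int ?N}" "y \<in> {0..<int ?N}" "?f x = ?f y"
    then have "int ?N dvd y - x" using eq by simp
    moreover have "\<bar>y - x\<bar> < int ?N" using xy by auto
    ultimately show "x = y" using dvd_imp_le_int[of "y - x" "int ?N"] by (cases "y = x") auto
  qed
  have img: "?f ` {0..<int ?N} = generate G {g}"
  proof (rule card_subset_eq)
    show "finite (generate G {g})"
      using generate_in_carrier[of "{g}"] assms by (meson finite_subset empty_subsetI insert_subset subsetI)
    show "?f ` {0..<int ?N} \<subseteq> generate G {g}"
      using generate_pow[OF assms(3)] by auto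
    show "card (?f ` {0..<int ?N}) = card (generate G {g})"
      using inj generate_pow_card[OF assms(3)] by (simp add: card_image)
  qed
  have "?f \<in> hom (integer_mod_group ?N) (G\<lparr>carrier := generate G {g}\<rparr>)"
  proof (rule homI)
    fix x y assume "x \<in> carrier (integer_mod_group ?N)" "y \<in> carrier (integer_mod_group ?N)"
    have "?f ((x + y) mod int ?N) = ?f (x + y)" unfolding eq by (simp add: dvd_minus_mod)
    then show "?f (x \<otimes>\<^bsub>integer_mod_group ?N\<^esub> y) = ?f x \<otimes>\<^bsub>G\<lparr>carrier := generate G {g}\<rparr>\<^esub> ?f y"
      using int_pow_mult[OF assms(3)] by simp
  qed (use img carr in auto)
  then show ?thesis
    using inj img carr by (intro is_isoI isoI) (auto simp: bij_betw_def)
qed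

text \<open>A cyclic subgroup \<open>C\<close> generated by an element \<open>g\<close> of maximal order is a direct factor. Let \<open>H\<close> be
  maximal among the subgroups that meet \<open>C\<close> trivially and suppose that \<open>H C\<close> is not everything. There is
  an \<open>x\<close> outside \<open>H C\<close> with \<open>x\<^sup>p = h g\<^sup>t\<close>. As the order of \<open>g\<close> kills \<open>x\<close>, the exponent \<open>t\<close> is divisible
  by \<open>p\<close>, so \<open>x\<close> can be corrected by a power of \<open>g\<close> to a \<open>y\<close> outside \<open>H C\<close> with \<open>y\<^sup>p \<in> H\<close>. Then
  the subgroup generated by \<open>H\<close> and \<open>y\<close> is larger than \<open>H\<close> and still meets \<open>C\<close> trivially.\<close>

lemma p_group_split_cyclic:
  assumes "comm_group G" "finite (carrier G)" "prime (p::nat)" "order G = p ^ n" "1 \<le> n"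
  obtains g H k where "g \<in> carrier G" "group.ord G g = p ^ k" "1 \<le> k" "subgroup H G"
    "generate G {g} \<inter> H \<subseteq> {\<one>\<^bsub>G\<^esub>}" "generate G {g} <#>\<^bsub>G\<^esub> H = carrier G"
proof -
  interpret comm_group G by fact
  have fin: "finite (carrier G)" by fact
  have ord_pp: "\<exists>i. ord x = p ^ i" if "x \<in> carrier G" for x
    using ord_dvd_group_order[OF that] assms(3,4) divides_primepow_nat by metis
  have "finite (ord ` carrier G)" "ord ` carrier G \<noteq> {}" using fin one_closed by auto
  then obtain g where g: "g \<in> carrier G" "\<And>x. x \<in> carrier G \<Longrightarrow> ord x \<le> ord g"
    using Max_in[of "ord ` carrier G"] Max_ge[of "ord ` carrier G"] by (metis (no_types, lifting) imageE imageI)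
  obtain k where k: "ord g = p ^ k" using ord_pp g(1) by blast
  have p1: "1 < p" using assms(3) prime_gt_1_nat by blast
  have exponent: "x [^]\<^bsub>G\<^esub> (p ^ k) = \<one>\<^bsub>G\<^esub>" if x: "x \<in> carrier G" for x
  proof -
    obtain i where i: "ord x = p ^ i" using ord_pp x by blast
    then have "p ^ i \<le> p ^ k" using g(2)[OF x] k by simp
    then have "i \<le> k" using p1 by simp
    then show ?thesis using pow_eq_id[OF x] i by (simp add: le_imp_power_dvd)
  qed
  have "1 \<le> k"
  proof (rule ccontr)
    assume "\<not> 1 \<le> k"
    then have "k = 0" by simp
    then have "x = \<one>\<^bsub>G\<^esub>" if "x \<in> carrier G" for x using exponent[OF that] that by simp
    then have "carrier G = {\<one>\<^bsub>G\<^esub>}" using one_closed by blast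
    moreover have "1 < p ^ n" using p1 assms(5) by (intro one_less_power) auto
    ultimately show False using assms(4) by (simp add: order_def)
  qed
  then obtain k' where k': "k = Suc k'" by (cases k) auto
  let ?C = "generate G {g}"
  have gen: "generate G {y} = {y [^]\<^bsub>G\<^esub> i | i::nat. True}" if "y \<in> carrier G" for y
    using generate_pow_on_finite_carrier[OF fin that] by simp
  have subC: "subgroup ?C G" using generate_is_subgroup g by simp
  have Cc: "?C \<subseteq> carrier G" using subC by (rule subgroup.subset)
  define \<F> where "\<F> = {H. subgroup H G \<and> H \<inter> ?C = {\<one>\<^bsub>G\<^esub>}}"
  have "finite \<F>"
    by (rule finite_subset[of _ "Pow (carrier G)"])
      (use fin in \<open>auto simp: \<F>_def dest: subgroup.subset\<close>)
  moreover have "{\<one>\<^bsub>G\<^esub>} \<in> \<F>"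
    using triv_subgroup subgroup.one_closed[OF subC] by (auto simp: \<F>_def)
  then have "\<F> \<noteq> {}" by blast
  ultimately have "\<exists>H\<in>\<F>. \<forall>H'\<in>\<F>. H \<subseteq> H' \<longrightarrow> H = H'"
    by (rule finite_has_maximal)
  then obtain H where "H \<in> \<F>" and max\<F>: "\<forall>H'\<in>\<F>. H \<subseteq> H' \<longrightarrow> H = H'" by (rule bexE)
  then have H: "subgroup H G" "H \<inter> ?C = {\<one>\<^bsub>G\<^esub>}" by (auto simp only: \<F>_def mem_Collect_eq)
  have max: "H = H'" if "subgroup H' G" "H' \<inter> ?C = {\<one>\<^bsub>G\<^esub>}" "H \<subseteq> H'" for H'
    using bspec[OF max\<F>, of H'] that by (simp add: \<F>_def)
  have Hc: "H \<subseteq> carrier G" using H(1) by (rule subgroup.subset)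
  let ?L = "H <#>\<^bsub>G\<^esub> ?C"
  have subL: "subgroup ?L G" by (rule mult_subgroups[OF H(1) subC])
  have HL: "H \<subseteq> ?L"
  proof
    fix h assume h: "h \<in> H"
    then have "h = h \<otimes>\<^bsub>G\<^esub> \<one>\<^bsub>G\<^esub>" using Hc by auto
    then show "h \<in> ?L" using h subgroup.one_closed[OF subC] unfolding set_mult_def by blast
  qed
  have CL: "?C \<subseteq> ?L"
  proof
    fix c assume c: "c \<in> ?C"
    then have "c = \<one>\<^bsub>G\<^esub> \<otimes>\<^bsub>G\<^esub> c" using Cc by auto
    then show "c \<in> ?L" using c subgroup.one_closed[OF H(1)] unfolding set_mult_def by blast
  qed
  have "carrier G \<subseteq> ?L"
  proof (rule ccontr)
    assume "\<not> carrier G \<subseteq> ?L"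
    then obtain x0 where x0: "x0 \<in> carrier G" "x0 \<notin> ?L" by blast
    \<comment> \<open>The last of the iterated p-th powers of \<open>x0\<close> that still lies outside \<open>H C\<close> serves as \<open>x\<close>.\<close>
    define i where "i = (LEAST i. x0 [^]\<^bsub>G\<^esub> (p ^ i) \<in> ?L)"
    have "x0 [^]\<^bsub>G\<^esub> (p ^ k) \<in> ?L" using exponent[OF x0(1)] subgroup.one_closed[OF subL] by simp
    then have i: "x0 [^]\<^bsub>G\<^esub> (p ^ i) \<in> ?L" unfolding i_def by (rule LeastI)
    then have "i \<noteq> 0" using x0 by (intro notI) simp
    then obtain i' where i': "i = Suc i'" by (cases i) auto
    define x where "x = x0 [^]\<^bsub>G\<^esub> (p ^ i')"
    have x: "x \<in> carrier G" using x0 by (simp add: x_def)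
    have "x \<notin> ?L" unfolding x_def using not_less_Least[of i' "\<lambda>i. x0 [^]\<^bsub>G\<^esub> (p ^ i) \<in> ?L"] i' i_def by simp
    have "x [^]\<^bsub>G\<^esub> p \<in> ?L" using i x0 i' by (simp add: x_def nat_pow_pow mult.commute)
    then obtain h t where ht: "h \<in> H" "x [^]\<^bsub>G\<^esub> p = h \<otimes>\<^bsub>G\<^esub> g [^]\<^bsub>G\<^esub> (t::nat)"
      unfolding set_mult_def gen[OF g(1)] by auto
    have hc: "h \<in> carrier G" using ht Hc by blast
    \<comment> \<open>The exponent \<open>p\<^sup>k\<close> kills \<open>x\<close>, so \<open>p\<^sup>k\<^sup>-\<^sup>1\<close> kills \<open>h g\<^sup>t\<close>.\<close>
    have "h [^]\<^bsub>G\<^esub> (p ^ k') \<otimes>\<^bsub>G\<^esub> g [^]\<^bsub>G\<^esub> (t * p ^ k') = \<one>\<^bsub>G\<^esub>"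
    proof -
      have "x [^]\<^bsub>G\<^esub> (p ^ k) = (x [^]\<^bsub>G\<^esub> p) [^]\<^bsub>G\<^esub> (p ^ k')"
        using x k' by (simp add: nat_pow_pow)
      then show ?thesis
        using exponent[OF x] hc g(1) by (simp add: ht nat_pow_distrib nat_pow_pow)
    qed
    then have "g [^]\<^bsub>G\<^esub> (t * p ^ k') = inv\<^bsub>G\<^esub> (h [^]\<^bsub>G\<^esub> (p ^ k'))"
      using hc g(1) by (metis inv_equality inv_inv nat_pow_closed m_comm)
    moreover have "inv\<^bsub>G\<^esub> (h [^]\<^bsub>G\<^esub> (p ^ k')) \<in> H"
      using subgroup_nat_pow_closed[OF H(1) ht(1)] subgroup.m_inv_closed[OF H(1)] by blast
    moreover have "g [^]\<^bsub>G\<^esub> (t * p ^ k') \<in> ?C" unfolding gen[OF g(1)] by blast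
    ultimately have "g [^]\<^bsub>G\<^esub> (t * p ^ k') = \<one>\<^bsub>G\<^esub>" using H(2) by auto
    then have "p * p ^ k' dvd t * p ^ k'" using pow_eq_id[OF g(1)] k k' by simp
    then have "p dvd t" using p1 by simp
    then obtain s where s: "t = p * s" by auto
    define y where "y = x \<otimes>\<^bsub>G\<^esub> inv\<^bsub>G\<^esub> (g [^]\<^bsub>G\<^esub> s)"
    have y: "y \<in> carrier G" using x g by (simp add: y_def)
    have yp: "y [^]\<^bsub>G\<^esub> p = h"
    proof -
      have "y [^]\<^bsub>G\<^esub> p = x [^]\<^bsub>G\<^esub> p \<otimes>\<^bsub>G\<^esub> inv\<^bsub>G\<^esub> (g [^]\<^bsub>G\<^esub> t)"
        using x g(1) s by (simp add: y_def nat_pow_distrib nat_pow_inv nat_pow_pow mult.commute)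
      then show ?thesis using ht hc g(1) by (simp add: m_assoc)
    qed
    have "y \<notin> ?L"
    proof
      assume "y \<in> ?L"
      moreover have "g [^]\<^bsub>G\<^esub> s \<in> ?L" using CL gen[OF g(1)] by blast
      ultimately have "y \<otimes>\<^bsub>G\<^esub> g [^]\<^bsub>G\<^esub> s \<in> ?L" using subgroup.m_closed[OF subL] by blast
      moreover have "y \<otimes>\<^bsub>G\<^esub> g [^]\<^bsub>G\<^esub> s = x" using x g(1) by (simp add: y_def m_assoc)
      ultimately show False using \<open>x \<notin> ?L\<close> by simp
    qed
    let ?D = "generate G {y}"
    have subD: "subgroup ?D G" using generate_is_subgroup y by simp
    let ?H' = "H <#>\<^bsub>G\<^esub> ?D"
    have subH': "subgroup ?H' G" by (rule mult_subgroups[OF H(1) subD])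
    have "H \<subseteq> ?H'"
    proof
      fix a assume a: "a \<in> H"
      then have "a = a \<otimes>\<^bsub>G\<^esub> \<one>\<^bsub>G\<^esub>" using Hc by auto
      then show "a \<in> ?H'" using a subgroup.one_closed[OF subD] unfolding set_mult_def by blast
    qed
    moreover have "y \<in> ?H'"
    proof -
      have "y = \<one>\<^bsub>G\<^esub> \<otimes>\<^bsub>G\<^esub> y" using y by simp
      then show ?thesis
        using generate.incl[of y "{y}"] subgroup.one_closed[OF H(1)] unfolding set_mult_def by blast
    qed
    moreover have "y \<notin> H" using \<open>y \<notin> ?L\<close> HL by blast
    ultimately have "?H' \<inter> ?C \<noteq> {\<one>\<^bsub>G\<^esub>}" using max[of ?H'] subH' by auto
    moreover have "\<one>\<^bsub>G\<^esub> \<in> ?H' \<inter> ?C" using subgroup.one_closed subH' subC by blast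
    ultimately obtain z where z: "z \<in> ?H'" "z \<in> ?C" "z \<noteq> \<one>\<^bsub>G\<^esub>" by blast
    then obtain a j where aj: "a \<in> H" "z = a \<otimes>\<^bsub>G\<^esub> y [^]\<^bsub>G\<^esub> (j::nat)"
      unfolding set_mult_def gen[OF y] by auto
    have ac: "a \<in> carrier G" using aj Hc by blast
    show False
    proof (cases "p dvd j")
      case True
      then obtain q where "j = p * q" by auto
      then have "y [^]\<^bsub>G\<^esub> j = h [^]\<^bsub>G\<^esub> q" using yp y by (simp flip: nat_pow_pow)
      then have "z \<in> H"
        using aj subgroup_nat_pow_closed[OF H(1) ht(1)] subgroup.m_closed[OF H(1)] by simp
      then show False using z H(2) by auto
    next
      case False
      have "y [^]\<^bsub>G\<^esub> j = inv\<^bsub>G\<^esub> a \<otimes>\<^bsub>G\<^esub> z" using aj ac y by (simp add: m_assoc[symmetric])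
      moreover have "inv\<^bsub>G\<^esub> a \<in> ?L" using HL aj(1) subgroup.m_inv_closed[OF H(1)] by blast
      ultimately have yj: "y [^]\<^bsub>G\<^esub> j \<in> ?L" using CL z(2) subgroup.m_closed[OF subL] by auto
      \<comment> \<open>Since \<open>y\<^sup>p\<close> and \<open>y\<^sup>j\<close> lie in \<open>H C\<close>, so would \<open>y\<close>.\<close>
      have "coprime p j" using False assms(3) by (simp add: prime_imp_coprime)
      moreover have "j \<noteq> 0" using False by (intro notI) simp
      ultimately obtain u w where uw: "j * u = p * w + 1" using coprime_bezout_nat by blast
      have "(y [^]\<^bsub>G\<^esub> j) [^]\<^bsub>G\<^esub> u = h [^]\<^bsub>G\<^esub> w \<otimes>\<^bsub>G\<^esub> y"
        using y yp[symmetric] by (simp add: nat_pow_pow uw)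
      then have "y = inv\<^bsub>G\<^esub> (h [^]\<^bsub>G\<^esub> w) \<otimes>\<^bsub>G\<^esub> ((y [^]\<^bsub>G\<^esub> j) [^]\<^bsub>G\<^esub> u)"
        using y hc by (simp add: m_assoc[symmetric])
      moreover have "inv\<^bsub>G\<^esub> (h [^]\<^bsub>G\<^esub> w) \<in> ?L"
        using HL subgroup_nat_pow_closed[OF H(1) ht(1)] subgroup.m_inv_closed[OF H(1)] by blast
      ultimately have "y \<in> ?L" using subgroup_nat_pow_closed[OF subL yj] subgroup.m_closed[OF subL] by metis
      then show False using \<open>y \<notin> ?L\<close> by simp
    qed
  qed
  moreover have "?L \<subseteq> carrier G" using subL by (rule subgroup.subset)
  ultimately have "H <#>\<^bsub>G\<^esub> ?C = carrier G" by simp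
  moreover have "?C <#>\<^bsub>G\<^esub> H = H <#>\<^bsub>G\<^esub> ?C"
  proof -
    have "c \<otimes>\<^bsub>G\<^esub> h = h \<otimes>\<^bsub>G\<^esub> c" if "c \<in> ?C" "h \<in> H" for c h
      using that Cc Hc m_comm by blast
    then have "?C <#>\<^bsub>G\<^esub> H = (\<Union>c\<in>?C. \<Union>h\<in>H. {h \<otimes>\<^bsub>G\<^esub> c})"
      unfolding set_mult_def by (intro SUP_cong refl) simp
    also have "\<dots> = H <#>\<^bsub>G\<^esub> ?C" unfolding set_mult_def by blast
    finally show ?thesis .
  qed
  moreover have "?C \<inter> H \<subseteq> {\<one>\<^bsub>G\<^esub>}" using H(2) by (simp add: Int_commute)
  ultimately show thesis using that[OF g(1) k \<open>1 \<le> k\<close> H(1)] by simp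
qed

text \<open>Induction on the order. If it is divisible by two primes, split off a Sylow subgroup; if it is a
  prime power, split off a cyclic subgroup. A divisor of the product of the orders of the two factors
  is a product of divisors.\<close>

theorem divisors_in_spectrum_odd:
  assumes "comm_group G" "finite (carrier G)" "odd (order G)" "d dvd order G"
  shows "d \<in> Reidemeister_spectrum (G :: ('a, 'b) monoid_scheme)"
  using assms
proof (induction "order G" arbitrary: G d rule: less_induct)
  case less
  interpret comm_group G by fact
  have pos: "0 < order G" using less.prems order_gt_0_iff_finite by simp
  \<comment> \<open>It suffices to split off a factor all of whose divisors are realized.\<close>
  have combine: "d \<in> Reidemeister_spectrum G"
    if HK: "subgroup H G" "subgroup K G" "H \<inter> K \<subseteq> {\<one>\<^bsub>G\<^esub>}" "H <#>\<^bsub>G\<^esub> K = carrier G"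
      and H: "\<And>c. c dvd card H \<Longrightarrow> c \<in> Reidemeister_spectrum (G\<lparr>carrier := H\<rparr>)"
      and lt: "card K < order G" for H K
  proof -
    have o: "order G = card H * card K" using card_internal_product HK less.prems by blast
    then obtain c c' where c: "d = c * c'" "c dvd card H" "c' dvd card K"
      using less.prems(4) division_decomp by metis
    have finK: "finite K" using less.prems(2) HK(2) by (meson finite_subset subgroup.subset)
    have "c' \<in> Reidemeister_spectrum (G\<lparr>carrier := K\<rparr>)"
      by (rule less.hyps) (use lt HK less.prems c o finK in \<open>auto simp: order_def intro!: comm_group_subgroup\<close>)
    then show ?thesis
      using spectrum_internal_product[OF less.prems(1,2) HK H[OF c(2)]] c(1) by simp
  qed
  show ?case
  proof (cases "order G = 1")
    case True
    then show ?thesis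
      using one_in_spectrum_odd[OF less.prems(1-3)] less.prems(4) by simp
  next
    case False
    then obtain p where p: "prime p" "p dvd order G" using prime_factor_nat by blast
    define n where "n = multiplicity p (order G)"
    obtain m where m: "order G = p ^ n * m" "\<not> p dvd m"
      using multiplicity_decompose'[of "order G" p] pos p(1) n_def
      by (metis not_prime_unit not_gr0)
    have n: "1 \<le> n" using m p by (cases n) auto
    have cop: "coprime (p ^ n) m" using m(2) p(1) by (simp add: prime_imp_coprime)
    have p1: "1 < p" "odd p" using p less.prems(3) prime_gt_1_nat dvd_trans by blast+
    show ?thesis
    proof (cases "m = 1")
      case True
      then have "order G = p ^ n" using m by simp
      then obtain g H k where g: "g \<in> carrier G" "ord g = p ^ k" "1 \<le> k" and H: "subgroup H G"
        "generate G {g} \<inter> H \<subseteq> {\<one>\<^bsub>G\<^esub>}" "generate G {g} <#>\<^bsub>G\<^esub> H = carrier G"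
        using p_group_split_cyclic[OF less.prems(1,2) p(1)] n by metis
      let ?C = "generate G {g}"
      have subC: "subgroup ?C G" using generate_is_subgroup g by simp
      have cardC: "card ?C = p ^ k" using generate_pow_card g by simp
      have spec: "Reidemeister_spectrum (integer_mod_group (p ^ k)) = Reidemeister_spectrum (G\<lparr>carrier := ?C\<rparr>)"
        using cyclic_subgroup_iso[OF is_group less.prems(2) g(1)] g(2) subC less.prems(1) p1
        by (intro spectrum_iso comm_group_subgroup) auto
      show ?thesis
      proof (rule combine[OF subC H])
        fix c assume "c dvd card ?C"
        then obtain j where j: "c = p ^ j" "j \<le> k"
          using cardC divides_primepow_nat[OF p(1)] by auto
        have "c \<in> Reidemeister_spectrum (integer_mod_group (p ^ k))"
        proof (cases "j = 0")
          case True
          then show ?thesis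
            using one_in_spectrum_odd[of "integer_mod_group (p ^ k)"] j p1
            by (simp add: order_def nat_power_eq)
        next
          case False
          then show ?thesis using prime_power_in_spectrum_cyclic[OF p(1)] j by simp
        qed
        then show "c \<in> Reidemeister_spectrum (G\<lparr>carrier := ?C\<rparr>)" using spec by simp
      next
        have "order G = p ^ k * card H" using card_internal_product[OF less.prems(1) subC H] cardC by simp
        moreover have "1 < p ^ k" using p1 g(3) by (intro one_less_power) auto
        ultimately show "card H < order G" using pos by simp
      qed
    next
      case False
      obtain S where S: "subgroup S G" "card S = p ^ n"
        using sylow_thm[OF p(1) is_group m(1) less.prems(2)] by blast
      let ?K = "{x \<in> carrier G. x [^]\<^bsub>G\<^esub> m = \<one>\<^bsub>G\<^esub>}"
      have oS: "order G = card S * m" "coprime (card S) m" using S m cop by simp_all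
      note K = hall_complement[OF less.prems(1,2) S(1) oS]
      have m1: "1 < m" using False pos m(1) by (cases m) auto
      have pn: "1 < p ^ n" using p1 n by (intro one_less_power) auto
      have finS: "finite S" using less.prems(2) S(1) by (meson finite_subset subgroup.subset)
      show ?thesis
      proof (rule combine[OF S(1) K(1-3)])
        show "card ?K < order G" using K(4) m(1) pn m1 by simp
        show "c \<in> Reidemeister_spectrum (G\<lparr>carrier := S\<rparr>)" if "c dvd card S" for c
          by (rule less.hyps)
            (use that S m m1 pn p1 less.prems finS in \<open>auto simp: order_def intro!: comm_group_subgroup\<close>)
      qed
    qed
  qed
qed

section \<open>The Reidemeister spectrum of a finite abelian group\<close>

lemma order_two_group:
  assumes "finite I"
  shows "order (two_group I e) = 2 ^ (\<Sum>i\<in>I. e i)"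
  using assms by (simp add: order_def carrier_two_group card_PiE nat_power_eq power_sum)

text \<open>A fixed point group is a subgroup of a 2-group, so the lower bound on its order is a divisibility.\<close>

theorem two_group_spectrum_lower:
  assumes "sorted e" "\<forall>x\<in>set e. 1 \<le> x"
    and "d \<in> Reidemeister_spectrum (two_group {..<length e} ((!) e))"
  shows "2 ^ (num_b e + num_c e) dvd d"
proof -
  let ?G = "two_group {..<length e} ((!) e)"
  obtain \<phi> where \<phi>: "\<phi> \<in> iso ?G ?G" "d = card (fixed_points ?G \<phi>)"
    using assms(3) by (auto simp: Reidemeister_spectrum_eq_card_fixed_points)
  interpret comm_group ?G by simp
  have "d dvd order ?G"
    using lagrange[OF subgroup_fixed_points[OF is_group]] \<phi> by (metis dvd_triv_right iso_imp_homomorphism)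
  then have "d dvd 2 ^ (\<Sum>i<length e. e ! i)" by (simp add: order_two_group)
  then obtain j where j: "d = 2 ^ j" using divides_primepow_nat[OF two_is_prime_nat] by blast
  moreover have "2 ^ (num_b e + num_c e) \<le> d"
    using card_fixed_points_of_type_ge[OF assms(1,2) \<phi>(1)] \<phi>(2) by simp
  ultimately show ?thesis by (simp add: le_imp_power_dvd)
qed

text \<open>An automorphism of \<open>A\<close> restricts to one of \<open>P\<close>, whose fixed points form a subgroup of all fixed
  points; this gives one inclusion. For the other, a divisor is split into its 2-part and its odd part,
  which are realized on \<open>P\<close> and on its complement.\<close>

theorem theorem4p17:
  fixes A :: "('a, 'b) monoid_scheme" and P :: "'a set" and e :: "nat list"
  assumes "comm_group A"
    and "finite (carrier A)"
    and "sylow_subgroup 2 P A"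
    and "has_type (A\<lparr>carrier := P\<rparr>) 2 e"
  shows "Reidemeister_spectrum A =
    {d :: nat. d dvd order A \<and> num_b e + num_c e \<le> multiplicity 2 d}"
proof -
  interpret comm_group A by fact
  let ?P = "A\<lparr>carrier := P\<rparr>" and ?T = "two_group {..<length e} ((!) e)"
  have P: "subgroup P A" "card P = 2 ^ multiplicity 2 (order A)"
    using assms(3) by (auto simp: sylow_subgroup_def)
  have pos: "0 < order A" using assms(2) order_gt_0_iff_finite by simp
  then obtain m where m: "order A = card P * m" "odd m"
    using multiplicity_decompose'[of "order A" 2] P(2)
    by (metis One_nat_def not_gr0 numeral_2_eq_2 odd_one)
  have cop: "coprime (card P) m" using m(2) P(2) by simp
  have cP: "comm_group ?P" using comm_group_subgroup[OF assms(1) P(1)] .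
  have finP: "finite P" using assms(2) P(1) by (meson finite_subset subgroup.subset)
  have e: "sorted e" "\<forall>x\<in>set e. 1 \<le> x" and iso: "?P \<cong> ?T"
    using assms(4) by (auto simp: has_type_def types_def two_group_def)
  have specP: "Reidemeister_spectrum ?P = Reidemeister_spectrum ?T"
    using cP finP iso by (intro spectrum_iso) auto
  have cardP: "card P = 2 ^ (\<Sum>i<length e. e ! i)"
    using iso_same_card[OF iso] order_two_group[of "{..<length e}" "(!) e"] by (simp add: order_def)
  show ?thesis
  proof (rule subset_antisym; rule subsetI)
    fix d assume "d \<in> Reidemeister_spectrum A"
    then obtain \<psi> where \<psi>: "\<psi> \<in> iso A A" "d = card (fixed_points A \<psi>)"
      using Reidemeister_spectrum_eq_card_fixed_points[OF assms(1,2)] by auto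
    have hom: "\<psi> \<in> hom A A" using \<psi>(1) by (simp add: iso_def)
    have subF: "subgroup (fixed_points A \<psi>) A" by (rule subgroup_fixed_points[OF is_group hom])
    have "d dvd order A" using lagrange[OF subF] \<psi>(2) by (metis dvd_triv_right)
    have Pc: "P \<subseteq> carrier A" using P(1) by (rule subgroup.subset)
    \<comment> \<open>\<open>P\<close> is characteristic, as the set of elements whose order divides \<open>|P|\<close>.\<close>
    have \<psi>P: "\<psi> x \<in> P" if "x \<in> P" for x
    proof -
      have x: "x \<in> carrier A" using that Pc by blast
      have "x [^]\<^bsub>A\<^esub> card P = \<one>\<^bsub>A\<^esub>"
        using hall_subgroup_iff[OF assms(1,2) P(1) m(1) cop x] that by simp
      then have "\<psi> x [^]\<^bsub>A\<^esub> card P = \<one>\<^bsub>A\<^esub>"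
        using hom_nat_pow[OF hom x is_group is_group, of "card P"] hom_one[OF hom is_group is_group] by simp
      then show ?thesis
        using hall_subgroup_iff[OF assms(1,2) P(1) m(1) cop hom_in_carrier[OF hom x]] by simp
    qed
    have "\<psi> \<in> hom ?P ?P" using hom_mult[OF hom] Pc \<psi>P
      by (intro homI) (auto simp: subsetD)
    then have "\<psi> \<in> iso ?P ?P"
    proof (rule finite_endo_isoI[rotated 2])
      fix x assume x: "x \<in> carrier ?P" "\<psi> x = \<one>\<^bsub>?P\<^esub>"
      then have "\<psi> x = \<psi> \<one>\<^bsub>A\<^esub>" "x \<in> carrier A"
        using hom_one[OF hom is_group is_group] Pc by auto
      then show "x = \<one>\<^bsub>?P\<^esub>"
        using \<psi>(1) by (auto simp: iso_def bij_betw_def inj_on_def)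
    qed (use cP finP in \<open>auto simp: comm_group_def\<close>)
    then have "card (fixed_points ?P \<psi>) \<in> Reidemeister_spectrum ?T"
      using card_fixed_points_in_spectrum[OF cP] finP specP by simp
    then have "2 ^ (num_b e + num_c e) dvd card (fixed_points ?P \<psi>)"
      using two_group_spectrum_lower[OF e] by blast
    also have "card (fixed_points ?P \<psi>) dvd d"
    proof -
      have F: "fixed_points ?P \<psi> = P \<inter> fixed_points A \<psi>"
        using Pc by (auto simp: fixed_points_def)
      then have "subgroup (fixed_points ?P \<psi>) (A\<lparr>carrier := fixed_points A \<psi>\<rparr>)"
        using subgroup_incl subgroups_Inter_pair P(1) subF by (metis inf_le2)
      from group.lagrange[OF subgroup.subgroup_is_group[OF subF is_group] this]
      have "card (fixed_points ?P \<psi>) dvd order (A\<lparr>carrier := fixed_points A \<psi>\<rparr>)"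
        by (rule dvdI[OF trans[OF sym mult.commute]])
      then show ?thesis using \<psi>(2) by (simp add: order_def)
    qed
    finally have "num_b e + num_c e \<le> multiplicity 2 d"
      using \<open>d dvd order A\<close> pos by (intro multiplicity_geI) (auto intro: Nat.gr0I)
    then show "d \<in> {d. d dvd order A \<and> num_b e + num_c e \<le> multiplicity 2 d}"
      using \<open>d dvd order A\<close> by simp
  next
    fix d assume "d \<in> {d. d dvd order A \<and> num_b e + num_c e \<le> multiplicity 2 d}"
    then have d: "d dvd order A" "num_b e + num_c e \<le> multiplicity 2 d" by auto
    let ?k = "multiplicity 2 d"
    obtain d' where d': "d = 2 ^ ?k * d'" "odd d'"
      using multiplicity_decompose'[of d 2] d(1) pos
      by (metis One_nat_def dvd_0_left_iff not_gr0 numeral_2_eq_2 odd_one)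
    have "?k \<le> multiplicity 2 (order A)"
      using d(1) pos by (intro dvd_imp_multiplicity_le) auto
    then have "?k \<le> (\<Sum>i<length e. e ! i)" using cardP P(2) by simp
    then have "2 ^ ?k \<in> Reidemeister_spectrum ?P"
      using realizes_from_type[OF e(2)] d(2) unfolding realizes_from_def specP by blast
    moreover
    note K = hall_complement[OF assms(1,2) P(1) m(1) cop]
    let ?K = "{x \<in> carrier A. x [^]\<^bsub>A\<^esub> m = \<one>\<^bsub>A\<^esub>}"
    have "d' dvd card P * m" using d(1) m(1) d'(1) by (metis dvd_mult_right)
    then have "d' dvd m" using d'(2) P(2) by (simp add: coprime_dvd_mult_right_iff)
    then have "d' \<in> Reidemeister_spectrum (A\<lparr>carrier := ?K\<rparr>)"
      using K m(2) comm_group_subgroup[OF assms(1) K(1)] assms(2)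
      by (intro divisors_in_spectrum_odd) (auto simp: order_def)
    ultimately show "d \<in> Reidemeister_spectrum A"
      using spectrum_internal_product[OF assms(1,2) P(1) K(1-3)] d'(1) by metis
  qed
qed

end
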